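(* Let $K$ be a non-archimedean local field with $\mathrm{char}(K)\neq 2$, and let $\pi\colon \mathrm{SL}_2(K)\to\mathrm{PSL}_2(K)$ be the natural quotient map. A discrete subgroup $G$ of $\mathrm{PSL}_2(K)$ can be lifted to a subgroup of $\mathrm{SL}_2(K)$ if and only if $G$ has no $2$-torsion (i.e. no elements of order $2$).
   Context: A subgroup $G\le \mathrm{PSL}_2(K)$ is said to lift to $\mathrm{SL}_2(K)$ if there is a homomorphism $\phi\colon G\to \mathrm{SL}_2(K)$ with $\pi\circ\phi=\mathrm{id}_G$. Discreteness refers to the topology on $\mathrm{PSL}_2(K)$ induced from the topology of the local field $K$. *)

theory Defs
  imports Complex_Main "HOL-Algebra.Coset"
begin

text \<open>A non-archimedean local field is given by a field type 'k together with an
  absolute value v on it which is non-archimedean (ultrametric), nontrivial,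
  discretely valued, has finite residue field, and for which 'k is complete.
  The topology of K is the one induced by the metric v (x - y).\<close>

definition nonarch_local_field :: "('k::field \<Rightarrow> real) \<Rightarrow> bool" where
  "nonarch_local_field v \<longleftrightarrow>
     (\<forall>x. 0 \<le> v x) \<and> (\<forall>x. v x = 0 \<longleftrightarrow> x = 0) \<and>
     (\<forall>x y. v (x * y) = v x * v y) \<and>
     (\<forall>x y. v (x + y) \<le> max (v x) (v y)) \<and>
     (\<exists>x. v x \<noteq> 0 \<and> v x \<noteq> 1) \<and>
     (\<exists>r<1. \<forall>x. v x < 1 \<longrightarrow> v x \<le> r) \<and>
     (\<exists>S. finite S \<and> S \<subseteq> {x. v x \<le> 1} \<and> (\<forall>x. v x \<le> 1 \<longrightarrow> (\<exists>s\<in>S. v (x - s) < 1))) \<and>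
     (\<forall>X::nat \<Rightarrow> 'k. (\<forall>e>0. \<exists>N. \<forall>m\<ge>N. \<forall>n\<ge>N. v (X m - X n) < e) \<longrightarrow>
        (\<exists>L. \<forall>e>0. \<exists>N. \<forall>n\<ge>N. v (X n - L) < e))"

datatype 'a mat2 = M2 'a 'a 'a 'a

fun m2mult :: "'a::comm_ring_1 mat2 \<Rightarrow> 'a mat2 \<Rightarrow> 'a mat2" where
  "m2mult (M2 a b c d) (M2 a' b' c' d') =
     M2 (a * a' + b * c') (a * b' + b * d') (c * a' + d * c') (c * b' + d * d')"

definition m2one :: "'a::comm_ring_1 mat2" where "m2one = M2 1 0 0 1"

definition m2neg_one :: "'a::comm_ring_1 mat2" where "m2neg_one = M2 (-1) 0 0 (-1)"

fun m2det :: "'a::comm_ring_1 mat2 \<Rightarrow> 'a" where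
  "m2det (M2 a b c d) = a * d - b * c"

definition SL2 :: "'a::comm_ring_1 mat2 monoid" where
  "SL2 = \<lparr>carrier = {A. m2det A = 1}, mult = m2mult, one = m2one\<rparr>"

definition centre2 :: "'a::comm_ring_1 mat2 set" where "centre2 = {m2one, m2neg_one}"

definition PSL2 :: "'a::comm_ring_1 mat2 set monoid" where
  "PSL2 = SL2 Mod centre2"

definition proj2 :: "'a::comm_ring_1 mat2 \<Rightarrow> 'a mat2 set" where
  "proj2 A = centre2 #>\<^bsub>SL2\<^esub> A"

text \<open>Distance between matrices induced by v (sup over entries; this gives the
  product topology on K^4).\<close>
fun m2dist :: "('k::field \<Rightarrow> real) \<Rightarrow> 'k mat2 \<Rightarrow> 'k mat2 \<Rightarrow> real" where
  "m2dist v (M2 a b c d) (M2 a' b' c' d') =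
     max (max (v (a - a')) (v (b - b'))) (max (v (c - c')) (v (d - d')))"

definition SL2_open :: "('k::field \<Rightarrow> real) \<Rightarrow> 'k mat2 set \<Rightarrow> bool" where
  "SL2_open v U \<longleftrightarrow> U \<subseteq> carrier SL2 \<and>
     (\<forall>A\<in>U. \<exists>e>0. \<forall>B\<in>carrier SL2. m2dist v A B < e \<longrightarrow> B \<in> U)"

definition PSL2_open :: "('k::field \<Rightarrow> real) \<Rightarrow> 'k mat2 set set \<Rightarrow> bool" where
  "PSL2_open v W \<longleftrightarrow> W \<subseteq> carrier PSL2 \<and> SL2_open v {A \<in> carrier SL2. proj2 A \<in> W}"

definition PSL2_discrete :: "('k::field \<Rightarrow> real) \<Rightarrow> 'k mat2 set set \<Rightarrow> bool" where
  "PSL2_discrete v G \<longleftrightarrow> (\<forall>g\<in>G. \<exists>W. PSL2_open v W \<and> g \<in> W \<and> W \<inter> G = {g})"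

definition lifts_to_SL2 :: "'k::comm_ring_1 mat2 set set \<Rightarrow> bool" where
  "lifts_to_SL2 G \<longleftrightarrow>
     (\<exists>\<phi>. \<phi> \<in> hom (PSL2\<lparr>carrier := G\<rparr>) SL2 \<and> (\<forall>g\<in>G. proj2 (\<phi> g) = g))"

definition has_2_torsion :: "'k::comm_ring_1 mat2 set set \<Rightarrow> bool" where
  "has_2_torsion G \<longleftrightarrow>
     (\<exists>g\<in>G. g \<noteq> \<one>\<^bsub>PSL2\<^esub> \<and> g \<otimes>\<^bsub>PSL2\<^esub> g = \<one>\<^bsub>PSL2\<^esub>)"

end

theory Submission
  imports Defs
begin

text \<open>Let \<open>H\<close> be the preimage of \<open>G\<close> in \<open>SL\<^sub>2\<close>. Lifting \<open>G\<close> amounts to finding a character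
  \<open>\<chi> : H \<rightarrow> {\<plusminus>1}\<close> with \<open>\<chi> (-1) = -1\<close>; its kernel is the lift. The group \<open>H\<close> acts on the Bruhat--Tits
  tree with finite vertex stabilisers, by discreteness. Modulo \<open>-1\<close> these have odd order when \<open>G\<close>
  has no 2-torsion, so each carries a unique character with the required value at \<open>-1\<close>: it is
  \<open>1\<close> exactly on the elements of odd order. These characters are therefore compatible with
  conjugation and with inclusions of edge stabilisers. They extend to a cocycle on the vertices
  that is a coboundary on the edges; since the tree is simply connected, correcting it by a
  potential makes it independent of the vertex, and it becomes a character of \<open>H\<close>.\<close>

section \<open>Finite groups with a central involution\<close>

text \<open>The obstacle is that having odd order is a multiplicative condition only inside a finite
  subgroup. It is nevertheless a single predicate on all of \<open>H\<close>, defined without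
  reference to a subgroup, and this is why the local characters agree wherever they meet. The gluing
  is the cohomological form of Bass--Serre theory with coefficients of order two: Shapiro's lemma
  treats vertices and edges orbit by orbit, and the tree contributes that every sign function on its
  edges is the coboundary of a function on its vertices. The tree enters through a distinguished
  end: each vertex has a parent, iterated parents never repeat, and any two vertices have a common
  ancestor. Over \<open>K\<close> this is the tree of closed balls, with the end at infinity. The
  group need not preserve the end, which only serves to compute the potential. Stabilisers are
  finite because discreteness at the identity meets the total boundedness of balls in
  \<open>K\<close>. That a lift excludes 2-torsion needs no tree: since 2 is nonzero,
  \<open>-1\<close> is the only involution of \<open>SL2\<close>.\<close>

locale central_involution = group H for H (structure) +
  fixes z
  assumes z_closed [simp]: "z \<in> carrier H"
    and z_neq_one: "z \<noteq> \<one>"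
    and z_square: "z \<otimes> z = \<one>"
    and z_central: "x \<in> carrier H \<Longrightarrow> z \<otimes> x = x \<otimes> z"
    and square_central: "u \<in> carrier H \<Longrightarrow> u \<otimes> u \<in> {\<one>, z} \<Longrightarrow> u \<in> {\<one>, z}"
begin

definition odd_order :: "'a \<Rightarrow> bool" where
  "odd_order g \<longleftrightarrow> (\<exists>k::nat. odd k \<and> g [^] k = \<one>)"

lemma z_cancel [simp]: "x \<in> carrier H \<Longrightarrow> z \<otimes> (z \<otimes> x) = x"
  by (metis l_one m_assoc z_closed z_square)

lemma z_mult_neq: "x \<in> carrier H \<Longrightarrow> z \<otimes> x \<noteq> x"
  using z_neq_one by simp

lemma z_left_commute:
  "x \<in> carrier H \<Longrightarrow> y \<in> carrier H \<Longrightarrow> x \<otimes> (z \<otimes> y) = z \<otimes> (x \<otimes> y)"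
  by (metis m_assoc z_central z_closed)

lemma z_pow_odd: "odd k \<Longrightarrow> z [^] (k::nat) = z"
proof (induction k rule: nat_less_induct)
  case (1 k)
  show ?case
  proof (cases "k = 1")
    case False
    with 1(2) obtain j where j: "k = Suc (Suc j)" "odd j"
      by (metis One_nat_def even_Suc even_zero old.nat.exhaust)
    then have "z [^] j = z" using 1(1) by simp
    then show ?thesis using j z_square by (simp add: m_assoc)
  qed simp
qed

lemma not_odd_order_z: "\<not> odd_order z"
  using z_neq_one z_pow_odd by (auto simp: odd_order_def)

text \<open>An even exponent can be halved, because \<open>square_central\<close> keeps the power in
  \<open>{\<one>, z}\<close>. At an odd exponent the power is \<open>\<one>\<close> or
  \<open>z\<close>, and in the second case replacing \<open>g\<close> by
  \<open>z \<otimes> g\<close> multiplies the power by \<open>z\<close>.\<close>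

lemma odd_order_or_z_mult:
  assumes "g \<in> carrier H" "0 < (n::nat)" "g [^] n \<in> {\<one>, z}"
  shows "odd_order g \<or> odd_order (z \<otimes> g)"
  using assms(2,3)
proof (induction n rule: less_induct)
  case (less n)
  show ?case
  proof (cases "even n")
    case True
    then obtain m where m: "n = m + m" by (metis evenE mult_2)
    then have "g [^] m \<otimes> g [^] m \<in> {\<one>, z}"
      using less.prems assms(1) by (simp add: nat_pow_mult)
    then have "g [^] m \<in> {\<one>, z}" using square_central assms(1) by blast
    then show ?thesis using less.IH[of m] less.prems(1) m by simp
  next
    case False
    have "(z \<otimes> g) [^] n = z \<otimes> g [^] n"
      using pow_mult_distrib[OF z_central[OF assms(1)] z_closed assms(1)] z_pow_odd False by simp
    then show ?thesis
      using False less.prems z_square by (auto simp: odd_order_def)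
  qed
qed

lemma finite_subgroup_exponent:
  assumes "subgroup P H" "finite P" "g \<in> P"
  shows "\<exists>n::nat. 0 < n \<and> g [^] n = \<one>"
proof -
  have g: "g \<in> carrier H" using assms subgroup.subset by blast
  have "g [^] (n::nat) \<in> P" for n
    using assms by (induction n) (auto simp: subgroup.one_closed subgroup.m_closed)
  then have "\<not> inj (\<lambda>n::nat. g [^] n)"
    using assms(2) by (metis finite_subset image_subsetI infinite_UNIV_nat finite_imageD)
  then obtain m n :: nat where "g [^] m = g [^] n" "m < n"
    by (metis injI linorder_neqE_nat)
  then have "g [^] (n - m) = \<one>"
    using g pow_eq_div2 by metis
  then show ?thesis using \<open>m < n\<close> by (meson zero_less_diff)
qed

text \<open>Characters with values in the two-element group are written as predicates: the group
  operation on truth values is equivalence, with neutral element \<^const>\<open>True\<close>.\<close>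

lemma sign_character_odd_order:
  assumes P: "subgroup P H" "finite P" "z \<in> P" "g \<in> P"
    and f: "\<And>x y. x \<in> P \<Longrightarrow> y \<in> P \<Longrightarrow> f (x \<otimes> y) \<longleftrightarrow> (f x \<longleftrightarrow> f y)"
    and fz: "\<not> f z"
  shows "f g \<longleftrightarrow> odd_order g"
proof -
  interpret P: subgroup P H by fact
  have f1: "f \<one>" using f[of \<one> \<one>] by simp
  have pow: "x [^] (n::nat) \<in> P \<and> (f (x [^] n) \<longleftrightarrow> even n \<or> f x)" if "x \<in> P" for x n
    using that by (induction n) (auto simp: f f1)
  have *: "f x" if "odd_order x" "x \<in> P" for x
    using that pow f1 unfolding odd_order_def by metis
  \<comment> \<open>A character is true on elements of odd order and takes opposite values at
    \<open>g\<close> and \<open>z \<otimes> g\<close>, so this alternative leaves it no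
    freedom.\<close>
  have "odd_order g \<or> odd_order (z \<otimes> g)"
    using finite_subgroup_exponent[OF P(1,2,4)] odd_order_or_z_mult[of g] P(4)
    by (metis P.mem_carrier insertI1)
  then show ?thesis
    using * P f[OF P(3,4)] fz by blast
qed

end

lemma even_card_involution:
  assumes "finite A" "\<And>x. x \<in> A \<Longrightarrow> i x \<in> A" "\<And>x. x \<in> A \<Longrightarrow> i (i x) = x"
    "\<And>x. x \<in> A \<Longrightarrow> i x \<noteq> x"
  shows "even (card A)"
  using assms
proof (induction "card A" arbitrary: A rule: less_induct)
  case less
  show ?case
  proof (cases "A = {}")
    case False
    then obtain a where a: "a \<in> A" by blast
    let ?B = "A - {a, i a}"
    have sub: "{a, i a} \<subseteq> A" and two: "card {a, i a} = 2"
      using a less.prems(2) less.prems(4)[OF a] by (auto simp: card_insert_if)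
    have card: "card A = card ?B + 2"
      using card_Diff_subset[OF _ sub] card_mono[OF less.prems(1) sub] two by simp
    have "even (card ?B)"
    proof (rule less.hyps)
      show "card ?B < card A" using card by simp
      fix x assume x: "x \<in> ?B"
      show "i x \<in> ?B" using x less.prems(2,3) a by (metis DiffE DiffI insertCI insertE singletonD)
    qed (use less.prems in auto)
    then show ?thesis using card by simp
  qed simp
qed

context central_involution
begin

text \<open>The character is the transfer of a finite subgroup \<open>P\<close> into \<open>{\<one>, z}\<close>, whose index is odd:
  \<open>R\<close> is a set of coset representatives, and inversion modulo \<open>z\<close> fixes only the
  representative of the trivial coset.\<close>

lemma finite_subgroup_character:
  assumes P: "subgroup P H" "finite P" "z \<in> P"
  obtains f where "\<And>x y. x \<in> P \<Longrightarrow> y \<in> P \<Longrightarrow> f (x \<otimes> y) \<longleftrightarrow> (f x \<longleftrightarrow> f y)" "\<not> f z"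
proof -
  interpret P: subgroup P H by fact
  \<comment> \<open>The choice depends only on the set \<open>{x, z \<otimes> x}\<close>, which is
    the same for \<open>x\<close> and \<open>z \<otimes> x\<close>; hence exactly one element of
    each coset is marked.\<close>
  define \<epsilon> where "\<epsilon> x \<longleftrightarrow> x = (SOME y. y \<in> {x, z \<otimes> x})" for x
  have eps_z: "\<epsilon> (z \<otimes> x) \<longleftrightarrow> \<not> \<epsilon> x" if "x \<in> P" for x
  proof -
    have x: "x \<in> carrier H" using that by simp
    have "(SOME y. y \<in> {z \<otimes> x, z \<otimes> (z \<otimes> x)}) = (SOME y. y \<in> {x, z \<otimes> x})"
      using x by (simp add: insert_commute)
    moreover have "(SOME y. y \<in> {x, z \<otimes> x}) \<in> {x, z \<otimes> x}"
      by (rule someI[of _ x]) simp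
    ultimately show ?thesis
      using z_mult_neq[OF x] unfolding \<epsilon>_def by (metis insertE singletonD)
  qed
  define R where "R = {x \<in> P. \<epsilon> x}"
  define norm where "norm x = (if \<epsilon> x then x else z \<otimes> x)" for x
  have norm_R: "norm x \<in> R" if "x \<in> P" for x
    using that eps_z P by (auto simp: norm_def R_def)
  have norm_cases: "norm x = x \<or> norm x = z \<otimes> x" for x by (simp add: norm_def)
  have norm_id: "norm x = x" if "x \<in> R" for x using that by (simp add: norm_def R_def)
  have norm_z: "norm (z \<otimes> x) = norm x" if "x \<in> P" for x
    using that eps_z by (auto simp: norm_def)
  have finR: "finite R" using P by (simp add: R_def)
  have RP: "x \<in> P" if "x \<in> R" for x using that by (simp add: R_def)
  define sg where "sg b = (if b then 1 else - 1 :: int)" for b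
  \<comment> \<open>The transfer: the product of the signs by which \<open>g\<close> moves the
    representatives away from representatives.\<close>
  define E where "E g = (\<Prod>x\<in>R. sg (\<epsilon> (g \<otimes> x)))" for g
  have bij: "bij_betw (\<lambda>x. norm (h \<otimes> x)) R R" if h: "h \<in> P" for h
  proof (rule bij_betw_byWitness[where f' = "\<lambda>x. norm (inv h \<otimes> x)"])
    have aux: "norm (k \<otimes> norm (l \<otimes> x)) = x" if "k \<in> P" "l \<in> P" "k \<otimes> l = \<one>" "x \<in> R" for k l x
    proof -
      have kl: "k \<otimes> (l \<otimes> x) = x" using that RP by (metis P.mem_carrier l_one m_assoc)
      have "k \<otimes> (z \<otimes> (l \<otimes> x)) = z \<otimes> x"
        using that RP kl by (simp add: z_left_commute)
      then show ?thesis
        using norm_cases[of "l \<otimes> x"] kl norm_z RP norm_id that by auto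
    qed
    show "\<forall>x\<in>R. norm (inv h \<otimes> norm (h \<otimes> x)) = x" "\<forall>x\<in>R. norm (h \<otimes> norm (inv h \<otimes> x)) = x"
      using h by (auto intro!: aux)
    show "(\<lambda>x. norm (h \<otimes> x)) ` R \<subseteq> R" "(\<lambda>x. norm (inv h \<otimes> x)) ` R \<subseteq> R"
      using h RP norm_R by auto
  qed
  have E_mult: "E (g \<otimes> h) = E g * E h" if "g \<in> P" "h \<in> P" for g h
  proof -
    \<comment> \<open>Renormalising \<open>h \<otimes> x\<close> before applying \<open>g\<close>
      costs precisely the sign in the second factor. As \<open>x\<close> runs through
      \<open>R\<close>, so does \<open>norm (h \<otimes> x)\<close>, which makes \<open>E\<close>
      multiplicative.\<close>
    have "sg (\<epsilon> (g \<otimes> h \<otimes> x)) = sg (\<epsilon> (g \<otimes> norm (h \<otimes> x))) * sg (\<epsilon> (h \<otimes> x))" if x: "x \<in> R" for x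
    proof (cases "\<epsilon> (h \<otimes> x)")
      case True
      then show ?thesis using \<open>g \<in> P\<close> \<open>h \<in> P\<close> RP[OF x] by (simp add: norm_def sg_def m_assoc)
    next
      case False
      have "g \<otimes> norm (h \<otimes> x) = z \<otimes> (g \<otimes> h \<otimes> x)"
        using \<open>g \<in> P\<close> \<open>h \<in> P\<close> RP[OF x] False by (simp add: norm_def z_left_commute m_assoc)
      then show ?thesis using \<open>g \<in> P\<close> \<open>h \<in> P\<close> RP[OF x] False by (simp add: eps_z sg_def)
    qed
    then have "E (g \<otimes> h) = (\<Prod>x\<in>R. sg (\<epsilon> (g \<otimes> norm (h \<otimes> x)))) * E h"
      by (simp add: E_def prod.distrib)
    then show ?thesis
      using prod.reindex_bij_betw[OF bij[OF that(2)], of "\<lambda>x. sg (\<epsilon> (g \<otimes> x))"] by (simp add: E_def)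
  qed
  have "odd (card R)"
  proof -
    let ?e = "norm \<one>"
    have e: "?e \<in> R" "?e \<in> {\<one>, z}" using norm_R norm_cases[of \<one>] by auto
    have "even (card (R - {?e}))"
    proof (rule even_card_involution[where i = "\<lambda>x. norm (inv x)"])
      fix x assume x: "x \<in> R - {?e}"
      then have xP: "x \<in> P" and xc: "x \<in> carrier H" using RP by auto
      have zi: "inv (z \<otimes> inv x) = z \<otimes> x"
        using xc z_square by (intro inv_equality) (simp_all add: m_assoc z_left_commute)
      show inv2: "norm (inv (norm (inv x))) = x"
        using norm_cases[of "inv x"] zi xc norm_z[OF xP] x norm_id by auto
      have central: "y = ?e" if "y \<in> R" "y \<in> {\<one>, z}" for y
        using that norm_id[OF that(1)] norm_z[of \<one>] by auto
      show "norm (inv x) \<noteq> x"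
      proof
        assume "norm (inv x) = x"
        then have "x = inv x \<or> x = z \<otimes> inv x" using norm_cases[of "inv x"] by auto
        then have "x \<otimes> x \<in> {\<one>, z}"
          using xc by (metis insertCI m_assoc l_inv inv_closed r_one z_closed)
        then show False using square_central xc central x by blast
      qed
      have "norm (inv x) \<noteq> ?e"
      proof
        assume "norm (inv x) = ?e"
        then have "inv (norm (inv x)) \<in> {\<one>, z}"
          using e(2) inv_equality[OF z_square] by auto
        then have "x \<in> {norm \<one>, norm z}" using inv2 by auto
        then show False using x norm_z[of \<one>] by auto
      qed
      then show "norm (inv x) \<in> R - {?e}" using norm_R xP by auto
    qed (use finR in simp)
    then show ?thesis using e(1) finR
      by (metis card_Suc_Diff1 even_Suc)
  qed
  \<comment> \<open>Multiplication by \<open>z\<close> flips every representative, so the odd index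
    gives the value \<open>- 1\<close>.\<close>
  moreover have "E z = (- 1) ^ card R"
  proof -
    have "sg (\<epsilon> (z \<otimes> x)) = - 1" if "x \<in> R" for x
      using that eps_z by (simp add: R_def sg_def)
    then show ?thesis by (simp add: E_def)
  qed
  ultimately have Ez: "E z = - 1" by simp
  have E_range: "E g = 1 \<or> E g = - 1" for g
    unfolding E_def by (induction R rule: infinite_finite_induct) (auto simp: sg_def)
  show thesis
  proof
    show "(E (x \<otimes> y) = 1) \<longleftrightarrow> ((E x = 1) \<longleftrightarrow> (E y = 1))" if "x \<in> P" "y \<in> P" for x y
      using E_mult[OF that] E_range[of x] E_range[of y] by auto
    show "\<not> E z = 1" using Ez by simp
  qed
qed

text \<open>The transfer supplies a character of \<open>P\<close>, and rigidity identifies it with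
  \<open>odd_order\<close>. The conclusion no longer mentions \<open>P\<close>, so it can be used
  for all stabilisers at once.\<close>

lemma odd_order_mult:
  assumes "subgroup P H" "finite P" "z \<in> P" "g \<in> P" "h \<in> P"
  shows "odd_order (g \<otimes> h) \<longleftrightarrow> (odd_order g \<longleftrightarrow> odd_order h)"
proof -
  obtain f where f: "\<And>x y. x \<in> P \<Longrightarrow> y \<in> P \<Longrightarrow> f (x \<otimes> y) \<longleftrightarrow> (f x \<longleftrightarrow> f y)" "\<not> f z"
    using finite_subgroup_character assms by blast
  then have "f x \<longleftrightarrow> odd_order x" if "x \<in> P" for x
    using sign_character_odd_order[of P x f] assms that by blast
  then show ?thesis
    using f(1) assms subgroup.m_closed[OF assms(1)] by metis
qed

lemma conjugate_pow:
  assumes "g \<in> carrier H" "t \<in> carrier H"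
  shows "(inv t \<otimes> g \<otimes> t) [^] (k::nat) = inv t \<otimes> g [^] k \<otimes> t"
proof (induction k)
  case (Suc k)
  have "t \<otimes> (inv t \<otimes> (g \<otimes> t)) = g \<otimes> t"
    using assms by (metis inv_closed l_one m_assoc m_closed r_inv)
  then show ?case using Suc assms by (simp add: m_assoc)
qed (use assms in simp)

lemma odd_order_conjugate:
  assumes "g \<in> carrier H" "t \<in> carrier H"
  shows "odd_order (inv t \<otimes> g \<otimes> t) \<longleftrightarrow> odd_order g"
proof -
  have "inv t \<otimes> y \<otimes> t = \<one> \<longleftrightarrow> y = \<one>" if "y \<in> carrier H" for y
    using assms that by (metis inv_closed inv_inv l_inv m_closed r_inv r_one inv_equality m_assoc l_one)
  then show ?thesis using assms by (simp add: odd_order_def conjugate_pow)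
qed

end

section \<open>Actions on trees\<close>

locale set_action = group H for H (structure) +
  fixes act :: "'a \<Rightarrow> 'v \<Rightarrow> 'v" and V :: "'v set"
  assumes act_closed [simp]: "g \<in> carrier H \<Longrightarrow> x \<in> V \<Longrightarrow> act g x \<in> V"
    and act_one [simp]: "x \<in> V \<Longrightarrow> act \<one> x = x"
    and act_mult: "g \<in> carrier H \<Longrightarrow> h \<in> carrier H \<Longrightarrow> x \<in> V \<Longrightarrow> act (g \<otimes> h) x = act g (act h x)"
begin

lemma act_inv_cancel [simp]:
  assumes "g \<in> carrier H" "x \<in> V"
  shows "act (inv g) (act g x) = x" "act g (act (inv g) x) = x"
  using assms act_mult[of "inv g" g x] act_mult[of g "inv g" x] by simp_all

lemma stabiliser_subgroup:
  assumes "x \<in> V"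
  shows "subgroup {g \<in> carrier H. act g x = x} H"
proof
  fix g assume "g \<in> {g \<in> carrier H. act g x = x}"
  then show "inv g \<in> {g \<in> carrier H. act g x = x}"
    using act_inv_cancel(1)[of g x] assms by auto
qed (use assms act_mult in auto)

text \<open>A 1-cocycle of \<open>H\<close> with values in the sign functions on \<open>V\<close>.
  One that does not depend on the point is a character of \<open>H\<close>.\<close>

definition cocycle :: "('a \<Rightarrow> 'v \<Rightarrow> bool) \<Rightarrow> bool" where
  "cocycle c \<longleftrightarrow> (\<forall>g\<in>carrier H. \<forall>h\<in>carrier H. \<forall>x\<in>V. c (g \<otimes> h) x \<longleftrightarrow> (c g (act h x) \<longleftrightarrow> c h x))"

lemma orbit_representatives:
  "\<exists>r t. (\<forall>x\<in>V. r x \<in> V \<and> t x \<in> carrier H \<and> act (t x) (r x) = x) \<and>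
    (\<forall>g\<in>carrier H. \<forall>x\<in>V. r (act g x) = r x)"
proof -
  define orb where "orb x = {act g x | g. g \<in> carrier H}" for x
  \<comment> \<open>The choice is made from the orbit as a set, so it is constant on orbits.\<close>
  define r where "r x = (SOME y. y \<in> orb x)" for x
  define t where "t x = (SOME g. g \<in> carrier H \<and> act g (r x) = x)" for x
  have r_orb: "r x \<in> orb x" for x
    unfolding r_def by (rule someI_ex) (auto simp: orb_def)
  have rV: "r x \<in> V" if "x \<in> V" for x
    using r_orb[of x] that by (auto simp: orb_def)
  have "\<exists>g. g \<in> carrier H \<and> act g (r x) = x" if x: "x \<in> V" for x
  proof -
    obtain g where "g \<in> carrier H" "r x = act g x"
      using r_orb[of x] by (auto simp: orb_def)
    then show ?thesis using x by (intro exI[of _ "inv g"]) simp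
  qed
  then have t: "t x \<in> carrier H \<and> act (t x) (r x) = x" if "x \<in> V" for x
    unfolding t_def using that by (intro someI_ex[of "\<lambda>g. g \<in> carrier H \<and> act g (r x) = x"]) blast
  have "orb (act g x) = orb x" if g: "g \<in> carrier H" "x \<in> V" for g x
  proof (intro equalityI subsetI)
    fix y assume "y \<in> orb (act g x)"
    then show "y \<in> orb x"
      using g by (auto simp: orb_def act_mult[symmetric])
  next
    fix y assume "y \<in> orb x"
    then obtain h where h: "h \<in> carrier H" "y = act h x" by (auto simp: orb_def)
    then have "y = act (h \<otimes> inv g) (act g x)"
      using g by (simp add: act_mult)
    then show "y \<in> orb (act g x)" using h g by (auto simp: orb_def)
  qed
  then have "r (act g x) = r x" if "g \<in> carrier H" "x \<in> V" for g x
    using that by (simp add: r_def)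
  then show ?thesis using rV t by (intro exI[of _ r] exI[of _ t]) blast
qed

text \<open>The injective half of Shapiro's lemma. The potential at \<open>x\<close> is the value of
  the cocycle on the element \<open>t x\<close> that carries the representative to \<open>x\<close>;
  two such elements differ by a stabiliser element, on which the cocycle is trivial.\<close>

lemma coboundary_if_trivial_on_stabilisers:
  assumes c: "cocycle c"
    and stab: "\<And>g x. g \<in> carrier H \<Longrightarrow> x \<in> V \<Longrightarrow> act g x = x \<Longrightarrow> c g x"
  shows "\<exists>b. \<forall>g\<in>carrier H. \<forall>x\<in>V. b (act g x) \<longleftrightarrow> (c g x \<longleftrightarrow> b x)"
proof -
  obtain r t where rt: "\<And>x. x \<in> V \<Longrightarrow> r x \<in> V" "\<And>x. x \<in> V \<Longrightarrow> t x \<in> carrier H"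
    "\<And>x. x \<in> V \<Longrightarrow> act (t x) (r x) = x"
    "\<And>g x. g \<in> carrier H \<Longrightarrow> x \<in> V \<Longrightarrow> r (act g x) = r x"
    using orbit_representatives by blast
  have "c (t (act g x)) (r (act g x)) \<longleftrightarrow> (c g x \<longleftrightarrow> c (t x) (r x))"
    if g: "g \<in> carrier H" and x: "x \<in> V" for g x
  proof -
    define t' where "t' = t (act g x)"
    define k where "k = inv t' \<otimes> (g \<otimes> t x)"
    have t': "t' \<in> carrier H" "act t' (r x) = act g x"
      using rt g x unfolding t'_def by (simp, metis act_closed)
    have fix_r: "act k (r x) = r x"
    proof -
      have "act k (r x) = act (inv t') (act g x)"
        using rt g x t' by (simp add: k_def act_mult)
      also have "\<dots> = r x"
        using t'(1) rt(1)[OF x] unfolding t'(2)[symmetric] by simp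
      finally show ?thesis .
    qed
    have k: "k \<in> carrier H" "t' \<otimes> k = g \<otimes> t x"
      using g t' rt(2)[OF x] by (simp_all add: k_def m_assoc[symmetric])
    have "c (t' \<otimes> k) (r x) \<longleftrightarrow> c t' (r x)"
      using c t' k(1) rt(1)[OF x] stab[OF k(1) rt(1)[OF x] fix_r] fix_r unfolding cocycle_def by metis
    moreover have "c (g \<otimes> t x) (r x) \<longleftrightarrow> (c g x \<longleftrightarrow> c (t x) (r x))"
      using c g rt x unfolding cocycle_def by metis
    ultimately show ?thesis using k(2) rt(4)[OF g x] by (simp add: t'_def)
  qed
  then show ?thesis by (intro exI[of _ "\<lambda>x. c (t x) (r x)"]) blast
qed

text \<open>The surjective half of Shapiro's lemma. Composing \<open>g\<close> with the chosen
  transporters gives an element \<open>k g x\<close> fixing the representative, where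
  \<open>s\<close> is multiplicative. Invariance under conjugation brings the result back to
  \<open>s\<close> on the stabiliser of \<open>x\<close> itself.\<close>

lemma cocycle_extending_stabiliser_characters:
  assumes s_mult: "\<And>g h x. g \<in> carrier H \<Longrightarrow> h \<in> carrier H \<Longrightarrow> x \<in> V \<Longrightarrow> act g x = x \<Longrightarrow> act h x = x \<Longrightarrow>
      s (g \<otimes> h) \<longleftrightarrow> (s g \<longleftrightarrow> s h)"
    and s_conj: "\<And>g t. g \<in> carrier H \<Longrightarrow> t \<in> carrier H \<Longrightarrow> s (inv t \<otimes> g \<otimes> t) \<longleftrightarrow> s g"
  obtains c where "cocycle c" "\<And>g x. g \<in> carrier H \<Longrightarrow> x \<in> V \<Longrightarrow> act g x = x \<Longrightarrow> c g x \<longleftrightarrow> s g"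
proof -
  obtain r t where rt: "\<And>x. x \<in> V \<Longrightarrow> r x \<in> V" "\<And>x. x \<in> V \<Longrightarrow> t x \<in> carrier H"
    "\<And>x. x \<in> V \<Longrightarrow> act (t x) (r x) = x"
    "\<And>g x. g \<in> carrier H \<Longrightarrow> x \<in> V \<Longrightarrow> r (act g x) = r x"
    using orbit_representatives by blast
  define k where "k g x = inv (t (act g x)) \<otimes> g \<otimes> t x" for g x
  have k_closed: "k g x \<in> carrier H" if "g \<in> carrier H" "x \<in> V" for g x
    using that rt by (simp add: k_def)
  have k_fix: "act (k g x) (r x) = r x" if g: "g \<in> carrier H" "x \<in> V" for g x
  proof -
    have "act (k g x) (r x) = act (inv (t (act g x))) (act g x)"
      using rt g by (simp add: k_def act_mult)
    moreover have "act (t (act g x)) (r x) = act g x"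
      using rt(3)[of "act g x"] rt(4) g by simp
    ultimately show ?thesis
      using rt(2)[of "act g x"] rt(1)[OF g(2)] g act_inv_cancel(1) by (metis act_closed)
  qed
  have k_mult: "k (g \<otimes> h) x = k g (act h x) \<otimes> k h x"
    if "g \<in> carrier H" "h \<in> carrier H" "x \<in> V" for g h x
  proof -
    have "t (act h x) \<otimes> (inv t (act h x) \<otimes> (h \<otimes> t x)) = h \<otimes> t x"
      using that rt by (simp add: m_assoc[symmetric])
    then show ?thesis
      using that rt by (simp add: k_def act_mult m_assoc)
  qed
  show thesis
  proof
    show "cocycle (\<lambda>g x. s (k g x))"
      unfolding cocycle_def
    proof (intro ballI)
      fix g h x assume gh: "g \<in> carrier H" "h \<in> carrier H" and x: "x \<in> V"
      show "s (k (g \<otimes> h) x) \<longleftrightarrow> (s (k g (act h x)) \<longleftrightarrow> s (k h x))"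
        unfolding k_mult[OF gh x]
        using gh x rt(4)[OF gh(2) x] k_fix[of g "act h x"]
        by (intro s_mult[of _ _ "r x"]) (simp_all add: rt k_closed k_fix)
    qed
    show "s (k g x) \<longleftrightarrow> s g" if "g \<in> carrier H" "x \<in> V" "act g x = x" for g x
      using that s_conj rt(2) by (simp add: k_def)
  qed
qed

end

text \<open>A tree with a distinguished end: \<open>p\<close> moves every vertex one step towards the end.\<close>

locale tree_action = set_action H act V for H (structure) and act :: "'a \<Rightarrow> 'v \<Rightarrow> 'v" and V +
  fixes E :: "'v \<Rightarrow> 'v \<Rightarrow> bool" and p :: "'v \<Rightarrow> 'v" and \<tau> :: "'v \<Rightarrow> bool"
  assumes edge_act: "g \<in> carrier H \<Longrightarrow> x \<in> V \<Longrightarrow> y \<in> V \<Longrightarrow> E x y \<Longrightarrow> E (act g x) (act g y)"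
    and edge_cases: "x \<in> V \<Longrightarrow> y \<in> V \<Longrightarrow> E x y \<Longrightarrow> y = p x \<or> x = p y"
    and p_closed [simp]: "x \<in> V \<Longrightarrow> p x \<in> V"
    and p_edge: "x \<in> V \<Longrightarrow> E x (p x)"
    and p_acyclic: "x \<in> V \<Longrightarrow> (p ^^ m) x = (p ^^ n) x \<Longrightarrow> m = n"
    and p_confluent: "x \<in> V \<Longrightarrow> y \<in> V \<Longrightarrow> \<exists>m n. (p ^^ m) x = (p ^^ n) y"
    and type_act: "g \<in> carrier H \<Longrightarrow> x \<in> V \<Longrightarrow> \<tau> (act g x) = \<tau> x"
    and type_edge: "x \<in> V \<Longrightarrow> y \<in> V \<Longrightarrow> E x y \<Longrightarrow> \<tau> x \<noteq> \<tau> y"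
begin

lemma p_pow_closed [simp]: "x \<in> V \<Longrightarrow> (p ^^ n) x \<in> V"
  by (induction n) auto

text \<open>This is where the simple connectivity of the tree enters.\<close>

lemma edge_potential:
  fixes \<beta> :: "'v \<Rightarrow> bool"
  obtains B where "\<And>x. x \<in> V \<Longrightarrow> \<beta> x \<longleftrightarrow> (B x \<longleftrightarrow> B (p x))"
proof (cases "V = {}")
  case False
  then obtain v where v: "v \<in> V" by blast
  \<comment> \<open>The total sign of \<open>\<beta>\<close> along the first \<open>n\<close> edges
    of the ray from \<open>x\<close> to the end.\<close>
  define Q where "Q n x = even (card {i. i < n \<and> \<not> \<beta> ((p ^^ i) x)})" for n x
  have Q0: "Q 0 x" for x by (simp add: Q_def)
  have Q_Suc: "Q (Suc n) x \<longleftrightarrow> (Q n x \<longleftrightarrow> \<beta> ((p ^^ n) x))" for n x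
  proof -
    have "{i. i < Suc n \<and> \<not> \<beta> ((p ^^ i) x)} =
        (if \<beta> ((p ^^ n) x) then {} else {n}) \<union> {i. i < n \<and> \<not> \<beta> ((p ^^ i) x)}"
      by (auto simp: less_Suc_eq)
    then show ?thesis by (simp add: Q_def)
  qed
  have Q_p: "Q (Suc n) x \<longleftrightarrow> (Q n (p x) \<longleftrightarrow> \<beta> x)" for n x
    by (induction n) (auto simp: Q0 Q_Suc simp flip: funpow_swap1)
  define meet where "meet x m n \<longleftrightarrow> (p ^^ m) x = (p ^^ n) v" for x m n
  \<comment> \<open>The sign of the path from \<open>x\<close> up to a meeting with the ray from
    \<open>v\<close> and back down to \<open>v\<close>. Two meetings differ by a common shift,
    because the ray from \<open>v\<close> never returns to a vertex; the shift contributes its sign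
    twice.\<close>
  define B where "B x \<longleftrightarrow> (\<exists>m n. meet x m n \<and> (Q m x \<longleftrightarrow> Q n v))" for x
  have shift: "meet x (m + k) (n + k) \<and> ((Q (m + k) x \<longleftrightarrow> Q (n + k) v) \<longleftrightarrow> (Q m x \<longleftrightarrow> Q n v))"
    if "meet x m n" for x m n k
    using that by (induction k) (auto simp: meet_def Q_Suc)
  have unique: "(Q m x \<longleftrightarrow> Q n v) \<longleftrightarrow> (Q m' x \<longleftrightarrow> Q n' v)"
    if "meet x m n" "meet x m' n'" "m \<le> m'" for x m n m' n'
  proof -
    from \<open>m \<le> m'\<close> obtain k where k: "m' = m + k" using le_Suc_ex by blast
    then have "n' = n + k"
      using shift[OF that(1), of k] that(2) p_acyclic[OF v] unfolding meet_def by metis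
    then show ?thesis using shift[OF that(1), of k] k by simp
  qed
  have B_eq: "B x \<longleftrightarrow> (Q m x \<longleftrightarrow> Q n v)" if "meet x m n" for x m n
    using unique[of x] that nat_le_linear unfolding B_def by metis
  show thesis
  proof (rule that[of B])
    fix x assume x: "x \<in> V"
    obtain m n where "meet (p x) m n"
      using p_confluent[of "p x" v] x v by (auto simp: meet_def)
    moreover from this have "meet x (Suc m) n"
      by (simp add: meet_def funpow_swap1)
    ultimately show "\<beta> x \<longleftrightarrow> (B x \<longleftrightarrow> B (p x))"
      using B_eq Q_p by metis
  qed
qed (use that in blast)

text \<open>Exactness in a Mayer--Vietoris sequence: characters of the vertex stabilisers that agree
  on edge stabilisers come from the whole group. Agreement is built in by using the same
  \<open>s\<close> at every vertex.\<close>

theorem global_character: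
  assumes "V \<noteq> {}"
    and s_mult: "\<And>g h x. g \<in> carrier H \<Longrightarrow> h \<in> carrier H \<Longrightarrow> x \<in> V \<Longrightarrow> act g x = x \<Longrightarrow> act h x = x \<Longrightarrow>
      s (g \<otimes> h) \<longleftrightarrow> (s g \<longleftrightarrow> s h)"
    and s_conj: "\<And>g t. g \<in> carrier H \<Longrightarrow> t \<in> carrier H \<Longrightarrow> s (inv t \<otimes> g \<otimes> t) \<longleftrightarrow> s g"
  obtains \<chi> where "\<And>g h. g \<in> carrier H \<Longrightarrow> h \<in> carrier H \<Longrightarrow> \<chi> (g \<otimes> h) \<longleftrightarrow> (\<chi> g \<longleftrightarrow> \<chi> h)"
    "\<And>g x. g \<in> carrier H \<Longrightarrow> x \<in> V \<Longrightarrow> act g x = x \<Longrightarrow> \<chi> g \<longleftrightarrow> s g"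
proof -
  obtain c where c: "cocycle c"
    and c_stab: "\<And>g x. g \<in> carrier H \<Longrightarrow> x \<in> V \<Longrightarrow> act g x = x \<Longrightarrow> c g x \<longleftrightarrow> s g"
    by (rule cocycle_extending_stabiliser_characters[of s]) (use s_mult s_conj in auto)
  have c_mult: "c (g \<otimes> h) x \<longleftrightarrow> (c g (act h x) \<longleftrightarrow> c h x)"
    if "g \<in> carrier H" "h \<in> carrier H" "x \<in> V" for g h x
    using that c by (simp add: cocycle_def)
  interpret pairs: set_action H "\<lambda>g. map_prod (act g) (act g)" "V \<times> V"
    by unfold_locales (auto simp: act_mult)
  \<comment> \<open>All ordered pairs are treated, not only edges: an element fixing a pair fixes
    both vertices, and there both values of \<open>c\<close> equal \<open>s g\<close>.\<close>
  define d where "d g = (\<lambda>(x, y). c g x \<longleftrightarrow> c g y)" for g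
  have "pairs.cocycle d"
    unfolding pairs.cocycle_def using c_mult by (auto simp: d_def)
  moreover have "d g e" if "g \<in> carrier H" "e \<in> V \<times> V" "map_prod (act g) (act g) e = e" for g e
    using that c_stab by (cases e) (simp add: d_def)
  ultimately obtain b where "\<forall>g\<in>carrier H. \<forall>e\<in>V \<times> V.
      b (map_prod (act g) (act g) e) \<longleftrightarrow> (d g e \<longleftrightarrow> b e)"
    using pairs.coboundary_if_trivial_on_stabilisers[of d] by blast
  then have b: "b (act g x, act g y) \<longleftrightarrow> ((c g x \<longleftrightarrow> c g y) \<longleftrightarrow> b (x, y))"
    if "g \<in> carrier H" "x \<in> V" "y \<in> V" for g x y
    using that by (auto simp: d_def dest!: bspec[of _ _ g] bspec[of _ _ "(x, y)"])
  \<comment> \<open>The values of \<open>b\<close> at \<open>(x, y)\<close> and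
    \<open>(y, x)\<close> are unrelated. Putting the vertex of type \<open>\<tau>\<close> in front
    makes \<open>b'\<close> symmetric on edges, and invariance of \<open>\<tau>\<close> preserves
    the transformation law.\<close>
  define b' where "b' x y = (if \<tau> x then b (x, y) else b (y, x))" for x y
  have b'_act: "b' (act g x) (act g y) \<longleftrightarrow> ((c g x \<longleftrightarrow> c g y) \<longleftrightarrow> b' x y)"
    if "g \<in> carrier H" "x \<in> V" "y \<in> V" for g x y
    using b[OF that] b[OF that(1,3,2)] that by (auto simp: b'_def type_act)
  obtain B where B: "\<And>x. x \<in> V \<Longrightarrow> b' x (p x) \<longleftrightarrow> (B x \<longleftrightarrow> B (p x))"
    using edge_potential[of "\<lambda>x. b' x (p x)"] by blast
  \<comment> \<open>Symmetry of \<open>b'\<close> is essential here: a group element may carry an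
    edge pointing to the end to one pointing away from it.\<close>
  have B_edge: "b' x y \<longleftrightarrow> (B x \<longleftrightarrow> B y)" if "x \<in> V" "y \<in> V" "E x y" for x y
    using edge_cases[OF that] type_edge[OF that] B[OF that(1)] B[OF that(2)]
    by (auto simp: b'_def)
  define X where "X g x \<longleftrightarrow> (c g x \<longleftrightarrow> (B (act g x) \<longleftrightarrow> B x))" for g x
  have X_p: "X g (p x) \<longleftrightarrow> X g x" if "g \<in> carrier H" "x \<in> V" for g x
    using B_edge[of "act g x" "act g (p x)"] B_edge[of x "p x"] b'_act[of g x "p x"]
      edge_act[of g x "p x"] p_edge[of x] that by (auto simp: X_def)
  have X_pow: "X g ((p ^^ n) x) \<longleftrightarrow> X g x" if "g \<in> carrier H" "x \<in> V" for g x n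
    using that by (induction n) (simp_all add: X_p)
  have X_const: "X g x \<longleftrightarrow> X g y" if "g \<in> carrier H" "x \<in> V" "y \<in> V" for g x y
    using p_confluent[OF that(2,3)] X_pow that by metis
  obtain v where v: "v \<in> V" using \<open>V \<noteq> {}\<close> by blast
  show thesis
  proof (rule that[of "\<lambda>g. X g v"])
    show "X (g \<otimes> h) v \<longleftrightarrow> (X g v \<longleftrightarrow> X h v)" if gh: "g \<in> carrier H" "h \<in> carrier H" for g h
      using X_const[OF gh(1) v, of "act h v"] c_mult[OF gh v] act_mult[OF gh v] gh v
      by (auto simp: X_def)
    show "X g v \<longleftrightarrow> s g" if "g \<in> carrier H" "x \<in> V" "act g x = x" for g x
      using X_const[OF that(1) v that(2)] c_stab[OF that] that by (simp add: X_def)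
  qed
qed

end

section \<open>The tree of the special linear group\<close>

lemma m2mult_assoc: "m2mult (m2mult A B) C = m2mult A (m2mult B C)"
  by (cases A; cases B; cases C) (simp add: algebra_simps)

lemma m2mult_one [simp]: "m2mult m2one A = A" "m2mult A m2one = A"
  by (cases A; simp add: m2one_def)+

lemma m2det_mult [simp]: "m2det (m2mult A B) = m2det A * m2det B"
  by (cases A; cases B) (simp add: algebra_simps)

lemma m2det_one [simp]: "m2det m2one = 1"
  by (simp add: m2one_def)

text \<open>The adjugate stands in for the inverse; the missing division by the determinant is
  harmless because lattice classes ignore scalars.\<close>

fun m2adj :: "'a::comm_ring_1 mat2 \<Rightarrow> 'a mat2" where
  "m2adj (M2 a b c d) = M2 d (- b) (- c) a"

fun m2smult :: "'a::comm_ring_1 \<Rightarrow> 'a mat2 \<Rightarrow> 'a mat2" where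
  "m2smult k (M2 a b c d) = M2 (k * a) (k * b) (k * c) (k * d)"

lemma m2det_adj [simp]: "m2det (m2adj A) = m2det A"
  by (cases A) (simp add: algebra_simps)

lemma m2adj_mult: "m2adj (m2mult A B) = m2mult (m2adj B) (m2adj A)"
  by (cases A; cases B) (simp add: algebra_simps)

lemma m2adj_adj [simp]: "m2adj (m2adj A) = A"
  by (cases A) simp

lemma m2smult_one [simp]: "m2smult 1 A = A"
  by (cases A) simp

lemma m2adj_cancel:
  "m2mult (m2adj A) (m2mult A B) = m2smult (m2det A) B"
  "m2mult A (m2mult (m2adj A) B) = m2smult (m2det A) B"
  by (cases A; cases B; simp add: algebra_simps)+

lemma m2adj_self: "m2mult (m2adj A) A = m2smult (m2det A) m2one"
  using m2adj_cancel(1)[of A m2one] by simp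

lemma m2mult_smult [simp]:
  "m2mult A (m2smult k B) = m2smult k (m2mult A B)" "m2mult (m2smult k A) B = m2smult k (m2mult A B)"
  by (cases A; cases B; simp add: algebra_simps)+

lemma m2mult_neg_one:
  "m2mult m2neg_one A = m2smult (- 1) A" "m2mult A m2neg_one = m2smult (- 1) A"
  by (cases A; simp add: m2neg_one_def)+

lemma carrier_SL2: "A \<in> carrier SL2 \<longleftrightarrow> m2det A = 1"
  by (simp add: SL2_def)

lemma SL2_simps [simp]: "A \<otimes>\<^bsub>SL2\<^esub> B = m2mult A B" "\<one>\<^bsub>SL2\<^esub> = m2one"
  by (simp_all add: SL2_def)

lemma group_SL2: "group (SL2 :: 'a::comm_ring_1 mat2 monoid)"
proof (rule groupI)
  fix A :: "'a mat2" assume "A \<in> carrier SL2"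
  then show "\<exists>B\<in>carrier SL2. B \<otimes>\<^bsub>SL2\<^esub> A = \<one>\<^bsub>SL2\<^esub>"
    by (intro bexI[of _ "m2adj A"]) (simp_all add: carrier_SL2 m2adj_self)
qed (simp_all add: carrier_SL2 m2mult_assoc)

section \<open>Absolute values with a uniformiser, and the maximum norm\<close>

locale discrete_valuation =
  fixes v :: "'k::field \<Rightarrow> real" and \<pi> :: 'k
  assumes v_nonneg [simp]: "0 \<le> v x"
    and v_eq_0_iff [simp]: "v x = 0 \<longleftrightarrow> x = 0"
    and v_mult: "v (x * y) = v x * v y"
    and v_add: "v (x + y) \<le> max (v x) (v y)"
    and v_pi_pos [simp]: "0 < v \<pi>"
    and v_pi_less_1: "v \<pi> < 1"
    and v_less_1: "v x < 1 \<Longrightarrow> v x \<le> v \<pi>"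
begin

lemma v_0 [simp]: "v 0 = 0" by simp

lemma v_pos_iff [simp]: "0 < v x \<longleftrightarrow> x \<noteq> 0"
  using v_nonneg[of x] v_eq_0_iff[of x] by linarith

lemma v_1 [simp]: "v 1 = 1"
  using v_mult[of 1 1] v_eq_0_iff[of 1] by simp

lemma v_minus [simp]: "v (- x) = v x"
proof -
  have "v (- 1) * v (- 1) = 1"
    using v_mult[of "- 1" "- 1"] by simp
  then have "v (- 1) = 1"
    using v_nonneg[of "- 1"] by (metis abs_of_nonneg mult_cancel_left1 power2_eq_1_iff power2_eq_square abs_1 abs_minus_cancel)
  then show ?thesis using v_mult[of "- 1" x] by simp
qed

lemma v_minus_commute: "v (x - y) = v (y - x)"
  using v_minus[of "x - y"] by simp

lemma v_diff: "v (x - y) \<le> max (v x) (v y)"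
  using v_add[of x "- y"] by simp

lemma v_divide: "v (x / y) = v x / v y"
proof (cases "y = 0")
  case False
  then show ?thesis using v_mult[of "x / y" y] by (simp add: field_simps)
qed simp

lemma v_power: "v (x ^ n) = v x ^ n"
  by (induction n) (simp_all add: v_mult)

lemma v_power_int: "v (x powi n) = v x powi n"
proof (cases n)
  case (nonneg k)
  then show ?thesis by (simp add: v_power)
next
  case (neg k)
  then show ?thesis
    using v_divide[of 1 "x ^ Suc k"]
    by (simp only: power_int_minus power_int_of_nat inverse_eq_divide v_power v_1)
qed

lemma pi_neq_0 [simp]: "\<pi> \<noteq> 0"
  using v_pi_pos by (metis v_pos_iff)

lemma power_int_pi_inj: "v \<pi> powi m = v \<pi> powi n \<Longrightarrow> m = n"
  by (metis linorder_neqE less_irrefl power_int_strict_decreasing v_pi_less_1 v_pi_pos)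

text \<open>Dividing by the power of \<open>\<pi>\<close> given by the floor of the logarithm leaves
  a value in the interval from \<open>v \<pi>\<close> (excluded) to 1, where the gap below 1 permits
  only 1.\<close>

lemma v_eq_power_int:
  assumes "x \<noteq> 0"
  shows "\<exists>n::int. v x = v \<pi> powi n"
proof -
  define n where "n = \<lfloor>ln (v x) / ln (v \<pi>)\<rfloor>"
  have ln: "ln (v \<pi>) < 0" using v_pi_less_1 by simp
  have pw: "v \<pi> powi k = exp (of_int k * ln (v \<pi>))" for k
    using powr_real_of_int'[of "v \<pi>" k] by (simp add: powr_def)
  have x: "v x = exp (ln (v x))" using assms by simp
  have "of_int n \<le> ln (v x) / ln (v \<pi>)" "ln (v x) / ln (v \<pi>) < of_int n + 1"
    by (simp_all add: n_def)
  then have "ln (v x) \<le> of_int n * ln (v \<pi>)" "(of_int n + 1) * ln (v \<pi>) < ln (v x)"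
    using ln by (simp_all add: field_simps)
  then have le: "v x \<le> v \<pi> powi n" and less: "v \<pi> powi (n + 1) < v x"
    using x by (simp_all add: pw) (metis exp_le_cancel_iff, metis exp_less_cancel_iff)
  let ?u = "x / \<pi> powi n"
  have "\<not> v ?u < 1"
  proof
    assume "v ?u < 1"
    then have "v ?u \<le> v \<pi>" by (rule v_less_1)
    then have "v x \<le> v \<pi> powi (n + 1)"
      by (simp add: v_divide v_power_int field_simps power_int_add)
    then show False using less by simp
  qed
  then have "v x = v \<pi> powi n"
    using le by (simp add: v_divide v_power_int field_simps)
  then show ?thesis ..
qed

lemma v_le_divide_pi: "v y \<le> v y / v \<pi>"
  using v_pi_less_1 by (simp add: field_simps mult_left_le_one_le)

lemma v_less_imp: "v x < v y \<Longrightarrow> v x \<le> v \<pi> * v y"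
  using v_less_1[of "x / y"] by (cases "y = 0") (auto simp: v_divide field_simps)

fun m2norm :: "'k mat2 \<Rightarrow> real" where
  "m2norm (M2 a b c d) = max (max (v a) (v b)) (max (v c) (v d))"

lemma m2norm_nonneg [simp]: "0 \<le> m2norm A"
  by (cases A) (simp add: le_max_iff_disj)

lemma m2norm_smult: "m2norm (m2smult k A) = v k * m2norm A"
  by (cases A) (simp add: v_mult max_mult_distrib_left)

lemma m2norm_one [simp]: "m2norm m2one = 1"
  by (simp add: m2one_def)

lemma m2norm_adj [simp]: "m2norm (m2adj A) = m2norm A"
  by (cases A) (simp add: max.commute max.left_commute)

text \<open>The ultrametric inequality avoids a factor 2; this makes \<open>m2norm\<close> exactly
  submultiplicative and bounds the determinant by its square.\<close>

lemma v_sum_products_le: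
  assumes "v a \<le> r" "v b \<le> r" "v c \<le> s" "v d \<le> s"
  shows "v (a * c + b * d) \<le> r * s"
proof -
  have "v (a * c) \<le> r * s" "v (b * d) \<le> r * s"
    unfolding v_mult using assms by (auto intro!: mult_mono order_trans[OF v_nonneg])
  then show ?thesis using v_add[of "a * c" "b * d"] by simp
qed

lemma m2norm_mult: "m2norm (m2mult A B) \<le> m2norm A * m2norm B"
proof -
  obtain a b c d a' b' c' d' where A: "A = M2 a b c d" and B: "B = M2 a' b' c' d'"
    by (cases A; cases B) auto
  have "v a \<le> m2norm A" "v b \<le> m2norm A" "v c \<le> m2norm A" "v d \<le> m2norm A"
    "v a' \<le> m2norm B" "v b' \<le> m2norm B" "v c' \<le> m2norm B" "v d' \<le> m2norm B"
    by (simp_all add: A B)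
  then show ?thesis
    by (subst A, subst B) (simp add: v_sum_products_le)
qed

lemma v_det_le: "v (m2det A) \<le> (m2norm A)\<^sup>2"
proof -
  obtain a b c d where A: "A = M2 a b c d" by (cases A)
  have "v a \<le> m2norm A" "v b \<le> m2norm A" "v c \<le> m2norm A" "v d \<le> m2norm A"
    by (simp_all add: A)
  then have "v (a * d + b * (- c)) \<le> m2norm A * m2norm A"
    by (intro v_sum_products_le) simp_all
  then show ?thesis by (simp add: A power2_eq_square)
qed

section \<open>Distance between lattice classes\<close>

text \<open>The exponential of the distance in the Bruhat--Tits tree between the classes of the
  lattices \<open>A \<O>\<^sup>2\<close> and \<open>B \<O>\<^sup>2\<close>, to the base \<open>1 / v \<pi>\<close>.\<close>

definition \<Delta> :: "'k mat2 \<Rightarrow> 'k mat2 \<Rightarrow> real" where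
  "\<Delta> A B = (m2norm (m2mult (m2adj A) B))\<^sup>2 / (v (m2det A) * v (m2det B))"

lemma Delta_refl: "m2det A \<noteq> 0 \<Longrightarrow> \<Delta> A A = 1"
  by (simp add: \<Delta>_def m2adj_self m2norm_smult power2_eq_square)

lemma Delta_commute: "\<Delta> A B = \<Delta> B A"
proof -
  have "m2norm (m2mult (m2adj A) B) = m2norm (m2mult (m2adj B) A)"
    by (subst m2norm_adj[symmetric]) (simp add: m2adj_mult)
  then show ?thesis by (simp add: \<Delta>_def mult.commute)
qed

lemma Delta_mult_left:
  assumes "m2det g = 1"
  shows "\<Delta> (m2mult g A) (m2mult g B) = \<Delta> A B"
  using assms by (simp add: \<Delta>_def m2adj_mult m2mult_assoc m2adj_cancel)

lemma Delta_ge_1: "m2det A \<noteq> 0 \<Longrightarrow> m2det B \<noteq> 0 \<Longrightarrow> 1 \<le> \<Delta> A B"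
  using v_det_le[of "m2mult (m2adj A) B"] by (simp add: \<Delta>_def v_mult)

text \<open>Inserting \<open>B\<close> and its adjugate between the two factors costs
  \<open>m2det B\<close>, which the normalisation of \<open>\<Delta>\<close> absorbs. What remains
  is submultiplicativity of the norm.\<close>

lemma Delta_triangle:
  assumes "m2det A \<noteq> 0" "m2det B \<noteq> 0" "m2det C \<noteq> 0"
  shows "\<Delta> A C \<le> \<Delta> A B * \<Delta> B C"
proof -
  have "m2mult (m2mult (m2adj A) B) (m2mult (m2adj B) C) = m2smult (m2det B) (m2mult (m2adj A) C)"
    by (simp add: m2mult_assoc m2adj_cancel)
  then have "v (m2det B) * m2norm (m2mult (m2adj A) C)
      \<le> m2norm (m2mult (m2adj A) B) * m2norm (m2mult (m2adj B) C)"
    using m2norm_mult by (metis m2norm_smult)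
  then have "(v (m2det B) * m2norm (m2mult (m2adj A) C))\<^sup>2
      \<le> (m2norm (m2mult (m2adj A) B) * m2norm (m2mult (m2adj B) C))\<^sup>2"
    by (intro power_mono) simp_all
  then show ?thesis
    using assms by (simp add: \<Delta>_def field_simps power2_eq_square)
qed

lemma Delta_cong:
  assumes "m2det A \<noteq> 0" "m2det B \<noteq> 0" "m2det C \<noteq> 0" "\<Delta> A B = 1"
  shows "\<Delta> A C = \<Delta> B C"
  using Delta_triangle[of A B C] Delta_triangle[of B A C] assms by (simp add: Delta_commute)

text \<open>Its lattice class encodes the closed ball in \<open>K\<close> with centre
  \<open>a\<close> and radius \<open>v y\<close>; the lattice classes at distance zero are those of
  the same ball.\<close>

definition upper :: "'k \<Rightarrow> 'k \<Rightarrow> 'k mat2" where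
  "upper y a = M2 y a 0 1"

lemma det_upper [simp]: "m2det (upper y a) = y"
  by (simp add: upper_def)

lemma Delta_upper: "\<Delta> (upper y a) (upper y' a') = (max (max (v y) (v y')) (v (a - a')))\<^sup>2 / (v y * v y')"
  using v_minus_commute[of a a'] by (simp add: \<Delta>_def upper_def max.commute max.left_commute)

lemma square_max_eq_iff:
  fixes r s :: real
  assumes "0 < r" "0 < s"
  shows "(max (max r s) t)\<^sup>2 = r * s \<longleftrightarrow> r = s \<and> t \<le> r"
proof
  assume eq: "(max (max r s) t)\<^sup>2 = r * s"
  define m where "m = max (max r s) t"
  have m: "r \<le> m" "s \<le> m" "t \<le> m" "m * m = r * s"
    using eq by (auto simp: m_def power2_eq_square)
  have "r * s \<le> m * s" "m * s \<le> m * m" "r * s \<le> r * m" "r * m \<le> m * m"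
    using m(1,2) assms by (intro mult_right_mono mult_left_mono; linarith)+
  then have "m * s = m * m" "r * m = m * m" using m(4) by linarith+
  moreover have "m > 0" using m assms by simp
  ultimately have "s = m" "r = m" by simp_all
  then show "r = s \<and> t \<le> r" using m by simp
next
  assume "r = s \<and> t \<le> r"
  then show "(max (max r s) t)\<^sup>2 = r * s" by (simp add: power2_eq_square)
qed

lemma Delta_upper_eq_1_iff:
  assumes "y \<noteq> 0" "y' \<noteq> 0"
  shows "\<Delta> (upper y a) (upper y' a') = 1 \<longleftrightarrow> v y = v y' \<and> v (a - a') \<le> v y"
  using square_max_eq_iff[of "v y" "v y'" "v (a - a')"] assms
  by (simp add: Delta_upper eq_commute[of "v y * v y'"])

text \<open>Were the centres further apart than the larger radius, the gap between values would make
  both radii at most \<open>v \<pi>\<close> times that distance, and the vertices would be at least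
  two steps apart.\<close>

lemma Delta_upper_edge:
  assumes "y \<noteq> 0" "y' \<noteq> 0" "v y' \<le> v y" "\<Delta> (upper y a) (upper y' a') = 1 / v \<pi>"
  shows "v y' = v \<pi> * v y \<and> v (a - a') \<le> v y"
proof -
  define m where "m = max (v y) (v (a - a'))"
  have m: "m * m * v \<pi> = v y * v y'" "v y \<le> m" "v (a - a') \<le> m"
    using assms by (auto simp: m_def Delta_upper power2_eq_square field_simps max_absorb1)
  have "m = v y"
  proof (rule ccontr)
    assume "m \<noteq> v y"
    then have "m = v (a - a')" "v y < v (a - a')" by (auto simp: m_def max_def split: if_splits)
    then have le: "v y \<le> v \<pi> * m" and "0 < m"
      using v_less_imp le_less_trans[OF v_nonneg[of y]] by blast+
    have "v y * v y' \<le> (v \<pi> * m) * (v \<pi> * m)"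
      using le assms(3) \<open>0 < m\<close> by (intro mult_mono) auto
    also have "\<dots> < m * m * v \<pi>"
      using v_pi_less_1 \<open>0 < m\<close> by (simp add: mult.assoc mult.left_commute)
    finally show False using m(1) by simp
  qed
  then show ?thesis using m assms(1) by (auto simp: mult.commute)
qed

text \<open>The Iwasawa decomposition: the larger entry of the bottom row serves as pivot, an
  integral column operation clears the other one, and division by the pivot makes the corner 1. The
  witnesses are the resulting entries, up to a sign of \<open>y\<close> in the second case.\<close>

lemma upper_representative:
  assumes "m2det A \<noteq> 0"
  obtains y a where "y \<noteq> 0" "\<Delta> A (upper y a) = 1"
proof -
  obtain \<alpha> \<beta> \<gamma> \<delta> where A: "A = M2 \<alpha> \<beta> \<gamma> \<delta>" by (cases A)
  define D where "D = \<alpha> * \<delta> - \<beta> * \<gamma>"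
  have D: "D \<noteq> 0" using assms by (simp add: A D_def)
  show thesis
  proof (cases "v \<gamma> \<le> v \<delta>")
    case True
    then have "\<delta> \<noteq> 0" using D v_nonneg[of \<gamma>] v_eq_0_iff[of \<gamma>]
      by (auto simp: D_def simp del: v_eq_0_iff v_nonneg v_pos_iff)
    have "m2mult (m2adj A) (upper (D / \<delta>\<^sup>2) (\<beta> / \<delta>)) = M2 (D / \<delta>) 0 (- (\<gamma> * D / \<delta>\<^sup>2)) (D / \<delta>)"
      using \<open>\<delta> \<noteq> 0\<close> by (simp add: A upper_def D_def field_simps power2_eq_square)
    moreover have "v (\<gamma> * D / \<delta>\<^sup>2) \<le> v (D / \<delta>)"
      using True \<open>\<delta> \<noteq> 0\<close> by (simp add: v_divide v_mult power2_eq_square field_simps mult_left_mono)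
    ultimately have "m2norm (m2mult (m2adj A) (upper (D / \<delta>\<^sup>2) (\<beta> / \<delta>))) = v (D / \<delta>)"
      by simp
    then have "\<Delta> A (upper (D / \<delta>\<^sup>2) (\<beta> / \<delta>)) = (v (D / \<delta>))\<^sup>2 / (v D * v (D / \<delta>\<^sup>2))"
      by (simp add: \<Delta>_def) (simp add: A D_def)
    also have "\<dots> = 1"
      using D \<open>\<delta> \<noteq> 0\<close> by (simp add: v_divide v_mult power2_eq_square)
    finally show thesis using that[of "D / \<delta>\<^sup>2" "\<beta> / \<delta>"] D \<open>\<delta> \<noteq> 0\<close> by simp
  next
    case False
    then have "\<gamma> \<noteq> 0" using v_nonneg[of \<delta>] by auto
    have "m2mult (m2adj A) (upper (D / \<gamma>\<^sup>2) (\<alpha> / \<gamma>)) = M2 (\<delta> * D / \<gamma>\<^sup>2) (D / \<gamma>) (- (D / \<gamma>)) 0"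
      using \<open>\<gamma> \<noteq> 0\<close> by (simp add: A upper_def D_def field_simps power2_eq_square)
    moreover have "v (\<delta> * D / \<gamma>\<^sup>2) \<le> v (D / \<gamma>)"
      using False \<open>\<gamma> \<noteq> 0\<close> by (simp add: v_divide v_mult power2_eq_square field_simps mult_left_mono)
    ultimately have "m2norm (m2mult (m2adj A) (upper (D / \<gamma>\<^sup>2) (\<alpha> / \<gamma>))) = v (D / \<gamma>)"
      by simp
    then have "\<Delta> A (upper (D / \<gamma>\<^sup>2) (\<alpha> / \<gamma>)) = (v (D / \<gamma>))\<^sup>2 / (v D * v (D / \<gamma>\<^sup>2))"
      by (simp add: \<Delta>_def) (simp add: A D_def)
    also have "\<dots> = 1"
      using D \<open>\<gamma> \<noteq> 0\<close> by (simp add: v_divide v_mult power2_eq_square)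
    finally show thesis using that[of "D / \<gamma>\<^sup>2" "\<alpha> / \<gamma>"] D \<open>\<gamma> \<noteq> 0\<close> by simp
  qed
qed

section \<open>Vertices, edges and the distinguished end\<close>

definition vertex :: "'k mat2 \<Rightarrow> 'k mat2 set" where
  "vertex A = {B. m2det B \<noteq> 0 \<and> \<Delta> A B = 1}"

definition vertices :: "'k mat2 set set" where
  "vertices = vertex ` {A. m2det A \<noteq> 0}"

definition translate :: "'k mat2 \<Rightarrow> 'k mat2 set \<Rightarrow> 'k mat2 set" where
  "translate g x = m2mult g ` x"

definition adjacent :: "'k mat2 set \<Rightarrow> 'k mat2 set \<Rightarrow> bool" where
  "adjacent x y \<longleftrightarrow> (\<exists>A\<in>x. \<exists>B\<in>y. \<Delta> A B = 1 / v \<pi>)"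

text \<open>The concentric ball of the next larger radius. A ball has many centres, hence the
  choice; \<open>parent_vertex_upper\<close> shows that the result does not depend on it.\<close>

definition parent :: "'k mat2 set \<Rightarrow> 'k mat2 set" where
  "parent x = (SOME z. \<exists>y a. y \<noteq> 0 \<and> x = vertex (upper y a) \<and> z = vertex (upper (y / \<pi>) a))"

text \<open>The parity of the valuation of the determinant; \<open>SL\<^sub>2\<close> preserves it, and neighbours differ
  in it, so \<open>SL\<^sub>2\<close> acts without inversions.\<close>

definition even_vertex :: "'k mat2 set \<Rightarrow> bool" where
  "even_vertex x \<longleftrightarrow> (\<exists>A\<in>x. \<exists>n::int. v (m2det A) = v \<pi> powi (2 * n))"

lemma vertex_self: "m2det A \<noteq> 0 \<Longrightarrow> A \<in> vertex A"
  by (simp add: vertex_def Delta_refl)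

lemma vertex_eq_iff:
  assumes "m2det A \<noteq> 0" "m2det B \<noteq> 0"
  shows "vertex A = vertex B \<longleftrightarrow> \<Delta> A B = 1"
proof
  assume "vertex A = vertex B"
  then show "\<Delta> A B = 1" using vertex_self[OF assms(2)] by (auto simp: vertex_def)
next
  assume "\<Delta> A B = 1"
  then show "vertex A = vertex B" using Delta_cong[OF assms] by (auto simp: vertex_def)
qed

lemma vertices_cases:
  assumes "x \<in> vertices"
  obtains y a where "y \<noteq> 0" "x = vertex (upper y a)"
proof -
  obtain A where A: "m2det A \<noteq> 0" "x = vertex A" using assms by (auto simp: vertices_def)
  obtain y a where "y \<noteq> 0" "\<Delta> A (upper y a) = 1" using upper_representative[OF A(1)] by blast
  then show thesis using that A vertex_eq_iff by simp
qed

lemma vertex_in_vertices [simp]: "m2det A \<noteq> 0 \<Longrightarrow> vertex A \<in> vertices"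
  by (simp add: vertices_def)

lemma translate_vertex:
  assumes "m2det g = 1"
  shows "translate g (vertex A) = vertex (m2mult g A)"
proof (intro equalityI subsetI)
  fix C assume C: "C \<in> vertex (m2mult g A)"
  have "C = m2mult g (m2mult (m2adj g) C)" using assms by (simp add: m2adj_cancel)
  moreover from this have "m2mult (m2adj g) C \<in> vertex A"
    using C assms Delta_mult_left[OF assms, of A "m2mult (m2adj g) C"] by (simp add: vertex_def)
  ultimately show "C \<in> translate g (vertex A)" by (auto simp: translate_def)
qed (auto simp: translate_def vertex_def assms Delta_mult_left)

lemma adjacent_vertex_iff:
  assumes "m2det A \<noteq> 0" "m2det B \<noteq> 0"
  shows "adjacent (vertex A) (vertex B) \<longleftrightarrow> \<Delta> A B = 1 / v \<pi>"
proof -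
  have "\<Delta> A' B' = \<Delta> A B" if "A' \<in> vertex A" "B' \<in> vertex B" for A' B'
    using that assms Delta_cong[of A A' B] Delta_cong[of B B' A']
    by (simp add: vertex_def Delta_commute)
  then show ?thesis
    using vertex_self assms unfolding adjacent_def by metis
qed

lemma parent_vertex_upper:
  assumes "y \<noteq> 0"
  shows "parent (vertex (upper y a)) = vertex (upper (y / \<pi>) a)"
proof -
  have "\<exists>y' a'. y' \<noteq> 0 \<and> vertex (upper y a) = vertex (upper y' a') \<and>
      parent (vertex (upper y a)) = vertex (upper (y' / \<pi>) a')"
    unfolding parent_def by (rule someI_ex) (use assms in blast)
  then obtain y' a' where *: "y' \<noteq> 0" "vertex (upper y a) = vertex (upper y' a')"
      "parent (vertex (upper y a)) = vertex (upper (y' / \<pi>) a')" by blast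
  then have eq: "v y = v y'" "v (a - a') \<le> v y"
    using assms by (simp_all add: vertex_eq_iff Delta_upper_eq_1_iff)
  have "\<Delta> (upper (y / \<pi>) a) (upper (y' / \<pi>) a') = 1"
    using eq assms *(1) v_le_divide_pi[of y] by (subst Delta_upper_eq_1_iff) (simp_all add: v_divide)
  then show ?thesis
    using assms * by (simp add: vertex_eq_iff Delta_commute)
qed

lemma parent_power_vertex_upper:
  assumes "y \<noteq> 0"
  shows "(parent ^^ n) (vertex (upper y a)) = vertex (upper (y / \<pi> ^ n) a)"
  by (induction n) (simp_all add: assms parent_vertex_upper mult.commute)

lemma adjacent_parent:
  assumes "x \<in> vertices"
  shows "adjacent x (parent x)"
proof -
  obtain y a where x: "y \<noteq> 0" "x = vertex (upper y a)" using vertices_cases[OF assms] .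
  have "\<Delta> (upper y a) (upper (y / \<pi>) a) = 1 / v \<pi>"
    using x v_le_divide_pi[of y] by (simp add: Delta_upper v_divide max_absorb1 max_absorb2 power2_eq_square)
  then show ?thesis using x by (simp add: parent_vertex_upper adjacent_vertex_iff)
qed

lemma adjacent_cases:
  assumes "x \<in> vertices" "y \<in> vertices" "adjacent x y"
  shows "y = parent x \<or> x = parent y"
proof -
  have child: "vertex (upper y a) = parent (vertex (upper y' a'))"
    if "y \<noteq> 0" "y' \<noteq> 0" "v y' \<le> v y" "\<Delta> (upper y a) (upper y' a') = 1 / v \<pi>" for y a y' a'
    using Delta_upper_edge[OF that] that
    by (simp add: parent_vertex_upper vertex_eq_iff Delta_upper_eq_1_iff v_divide)
  obtain s a t b where s: "s \<noteq> 0" "x = vertex (upper s a)" and t: "t \<noteq> 0" "y = vertex (upper t b)"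
    using vertices_cases assms by metis
  then have "\<Delta> (upper s a) (upper t b) = 1 / v \<pi>"
    using assms(3) by (simp add: adjacent_vertex_iff)
  then show ?thesis
    using child[OF s(1) t(1), of a b] child[OF t(1) s(1), of b a] s t
    by (metis Delta_commute linear)
qed

lemma parent_acyclic:
  assumes "x \<in> vertices" "(parent ^^ m) x = (parent ^^ n) x"
  shows "m = n"
proof -
  obtain y a where x: "y \<noteq> 0" "x = vertex (upper y a)" using vertices_cases[OF assms(1)] .
  then have "v \<pi> ^ m = v \<pi> ^ n"
    using assms(2)
    by (simp add: parent_power_vertex_upper vertex_eq_iff Delta_upper_eq_1_iff v_divide v_power)
  then show "m = n" using power_int_pi_inj[of m n] by simp
qed

lemma parent_confluent:
  assumes "x \<in> vertices" "y \<in> vertices"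
  shows "\<exists>m n. (parent ^^ m) x = (parent ^^ n) y"
proof -
  obtain s a t b where s: "s \<noteq> 0" "x = vertex (upper s a)" and t: "t \<noteq> 0" "y = vertex (upper t b)"
    using vertices_cases assms by metis
  obtain i j :: int where ij: "v s = v \<pi> powi i" "v t = v \<pi> powi j"
    using v_eq_power_int s t by metis
  have "\<exists>k. v \<pi> ^ k * v (a - b) < v s"
  proof -
    have "(\<lambda>k. v \<pi> ^ k * v (a - b)) \<longlonglongrightarrow> 0"
      using LIMSEQ_power_zero[of "v \<pi>"] v_pi_less_1 by (intro tendsto_mult_left_zero) simp
    then show ?thesis
      using order_tendstoD(2)[of _ 0 sequentially "v s"] s(1) by (auto simp: eventually_sequentially)
  qed
  then obtain k where k: "v (a - b) < v s / v \<pi> ^ k"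
    by (auto simp: field_simps)
  \<comment> \<open>At least one of the two \<open>nat\<close> terms vanishes, and together they
    equalise the radii; \<open>k\<close> makes the common radius exceed the distance of the
    centres.\<close>
  define m where "m = k + nat (i - j)"
  define n where "n = k + nat (j - i)"
  have "i + int n = j + int m" by (simp add: m_def n_def)
  then have "v \<pi> powi (i + int n) = v \<pi> powi (j + int m)" by simp
  then have eq: "v s / v \<pi> ^ m = v t / v \<pi> ^ n"
    by (simp add: ij power_int_add field_simps)
  have "v \<pi> ^ m \<le> v \<pi> ^ k"
    using v_pi_less_1 by (intro power_decreasing) (simp_all add: m_def)
  then have "v s / v \<pi> ^ k \<le> v s / v \<pi> ^ m"
    by (intro divide_left_mono) simp_all
  then have "vertex (upper (s / \<pi> ^ m) a) = vertex (upper (t / \<pi> ^ n) b)"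
    using eq k s(1) t(1) by (simp add: vertex_eq_iff Delta_upper_eq_1_iff v_divide v_power)
  then show ?thesis
    using s t by (metis parent_power_vertex_upper)
qed

section \<open>Parity of vertices and the action\<close>

lemma m2norm_attained: "\<exists>x. m2norm A = v x"
  by (cases A) (auto simp: max_def)

text \<open>The numerator of \<open>\<Delta>\<close> is a square, so the parity of the distance is
  that of \<open>i + j\<close>. Hence the parity of the determinant is constant on a vertex and
  changes along an edge.\<close>

lemma Delta_eq_power_int:
  assumes "m2det A \<noteq> 0" "m2det B \<noteq> 0" "v (m2det A) = v \<pi> powi i" "v (m2det B) = v \<pi> powi j"
  shows "\<exists>m. \<Delta> A B = v \<pi> powi (2 * m - i - j)"
proof -
  obtain x where x: "m2norm (m2mult (m2adj A) B) = v x" using m2norm_attained by blast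
  have "x \<noteq> 0"
    using Delta_ge_1[OF assms(1,2)] x by (auto simp: \<Delta>_def)
  then obtain m where m: "v x = v \<pi> powi m" using v_eq_power_int by blast
  have "v \<pi> powi (m + m - i - j) = \<Delta> A B"
    unfolding \<Delta>_def x m assms(3,4) power2_eq_square
    by (simp only: power_int_diff power_int_add pi_neq_0 v_eq_0_iff not_False_eq_True simp_thms divide_divide_eq_left)
  then have "\<Delta> A B = v \<pi> powi (2 * m - i - j)" by (simp only: mult_2)
  then show ?thesis ..
qed

lemma even_vertex_vertex:
  assumes "m2det A \<noteq> 0" "v (m2det A) = v \<pi> powi i"
  shows "even_vertex (vertex A) \<longleftrightarrow> even i"
proof
  assume "even_vertex (vertex A)"
  then obtain B n where B: "m2det B \<noteq> 0" "\<Delta> A B = 1" "v (m2det B) = v \<pi> powi (2 * n)"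
    by (auto simp: even_vertex_def vertex_def)
  obtain m where "v \<pi> powi 0 = v \<pi> powi (2 * m - i - 2 * n)"
    using Delta_eq_power_int[OF assms(1) B(1) assms(2) B(3)] B(2) by auto
  then have "0 = 2 * m - i - 2 * n" by (rule power_int_pi_inj)
  then show "even i" by presburger
next
  assume "even i"
  then show "even_vertex (vertex A)"
    using vertex_self[OF assms(1)] assms(2) unfolding even_vertex_def by (metis evenE)
qed

lemma even_vertex_adjacent:
  assumes "x \<in> vertices" "y \<in> vertices" "adjacent x y"
  shows "even_vertex x \<noteq> even_vertex y"
proof -
  obtain A B where AB: "m2det A \<noteq> 0" "m2det B \<noteq> 0" "x = vertex A" "y = vertex B"
    using assms by (auto simp: vertices_def)
  obtain i j where ij: "v (m2det A) = v \<pi> powi i" "v (m2det B) = v \<pi> powi j"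
    using v_eq_power_int AB(1,2) by metis
  obtain m where "v \<pi> powi (- 1) = v \<pi> powi (2 * m - i - j)"
    using Delta_eq_power_int[OF AB(1,2) ij] assms(3) AB
    by (auto simp: adjacent_vertex_iff power_int_minus inverse_eq_divide)
  then have "- 1 = 2 * m - i - j" by (rule power_int_pi_inj)
  then have "even i \<noteq> even j" by presburger
  then show ?thesis using AB ij by (simp add: even_vertex_vertex)
qed

lemma translate_neg_one:
  assumes "x \<in> vertices"
  shows "translate m2neg_one x = x"
proof -
  obtain A where A: "m2det A \<noteq> 0" "x = vertex A" using assms by (auto simp: vertices_def)
  have "\<Delta> A (m2mult m2neg_one A) = \<Delta> A A"
    by (simp add: \<Delta>_def m2mult_neg_one m2norm_smult) (simp add: m2neg_one_def flip: m2mult_neg_one)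
  then show ?thesis
    using A by (simp add: translate_vertex vertex_eq_iff Delta_commute Delta_refl m2neg_one_def)
qed

lemma tree_action_SL2:
  assumes "subgroup H SL2"
  shows "tree_action (SL2\<lparr>carrier := H\<rparr>) translate vertices adjacent parent even_vertex"
proof -
  interpret G: group "SL2\<lparr>carrier := H\<rparr> :: 'k mat2 monoid"
    using subgroup.subgroup_is_group[OF assms group_SL2] .
  have H: "m2det g = 1" if "g \<in> H" for g
    using subgroup.subset[OF assms] that carrier_SL2 by blast
  show ?thesis
  proof unfold_locales
    fix g x y assume g: "g \<in> carrier (SL2\<lparr>carrier := H\<rparr>)" and x: "x \<in> vertices"
    then obtain A where A: "m2det A \<noteq> 0" "x = vertex A" by (auto simp: vertices_def)
    show "translate g x \<in> vertices"
      using A g by (simp add: translate_vertex H)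
    obtain i where "v (m2det A) = v \<pi> powi i" using v_eq_power_int A(1) by metis
    then show "even_vertex (translate g x) = even_vertex x"
      using A g by (simp add: translate_vertex H even_vertex_vertex)
    assume "y \<in> vertices" "adjacent x y"
    then obtain B where "m2det B \<noteq> 0" "y = vertex B" by (auto simp: vertices_def)
    then show "adjacent (translate g x) (translate g y)"
      using A g \<open>adjacent x y\<close> by (simp add: translate_vertex H adjacent_vertex_iff Delta_mult_left)
  next
    fix x assume "x \<in> vertices"
    then show "parent x \<in> vertices"
      by (metis vertices_cases parent_vertex_upper vertex_in_vertices det_upper divide_eq_0_iff pi_neq_0)
  qed (simp_all add: translate_def image_image m2mult_assoc adjacent_cases adjacent_parent
      parent_acyclic parent_confluent even_vertex_adjacent)
qed

section \<open>Finiteness of vertex stabilisers\<close>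

text \<open>The conjugate of \<open>g\<close> by \<open>A\<close> preserves the standard lattice and
  has norm 1. Conjugating back multiplies the bound by the norms of \<open>A\<close> and of its
  inverse, which is the adjugate over the determinant.\<close>

lemma m2norm_stabiliser_le:
  assumes "m2det g = 1" "m2det A \<noteq> 0" "translate g (vertex A) = vertex A"
  shows "m2norm g \<le> (m2norm A)\<^sup>2 / v (m2det A)"
proof -
  have "\<Delta> A (m2mult g A) = 1"
    using assms by (simp add: translate_vertex vertex_eq_iff Delta_commute)
  then have "(m2norm (m2mult (m2adj A) (m2mult g A)))\<^sup>2 = (v (m2det A))\<^sup>2"
    using assms by (simp add: \<Delta>_def power2_eq_square)
  then have eq: "m2norm (m2mult (m2adj A) (m2mult g A)) = v (m2det A)"
    by (simp add: power2_eq_iff_nonneg)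
  have "m2mult (m2mult A (m2mult (m2adj A) (m2mult g A))) (m2adj A) =
      m2smult (m2det A) (m2smult (m2det A) g)"
    using m2adj_cancel(1)[of "m2adj A" m2one] by (simp add: m2adj_cancel m2mult_assoc)
  then have "v (m2det A) * (v (m2det A) * m2norm g) \<le>
      m2norm (m2mult A (m2mult (m2adj A) (m2mult g A))) * m2norm (m2adj A)"
    by (metis m2norm_mult m2norm_smult)
  also have "\<dots> \<le> m2norm A * v (m2det A) * m2norm A"
    using m2norm_mult[of A "m2mult (m2adj A) (m2mult g A)"] by (simp add: eq mult_right_mono)
  finally show ?thesis
    using assms(2) by (simp add: field_simps power2_eq_square)
qed

fun m2diff :: "'k mat2 \<Rightarrow> 'k mat2 \<Rightarrow> 'k mat2" where
  "m2diff (M2 a b c d) (M2 a' b' c' d') = M2 (a - a') (b - b') (c - c') (d - d')"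

lemma m2dist_eq: "m2dist v A B = m2norm (m2diff A B)"
  by (cases A; cases B) simp

lemma m2mult_diff: "m2mult A (m2diff B C) = m2diff (m2mult A B) (m2mult A C)"
  by (cases A; cases B; cases C) (simp add: algebra_simps)

lemma m2dist_adj_mult:
  assumes "m2det A = 1"
  shows "m2dist v m2one (m2mult (m2adj A) B) \<le> m2norm A * m2dist v A B"
proof -
  have "m2diff m2one (m2mult (m2adj A) B) = m2mult (m2adj A) (m2diff A B)"
    using assms by (simp add: m2mult_diff m2adj_self)
  then show ?thesis
    using m2norm_mult[of "m2adj A"] by (simp add: m2dist_eq)
qed

text \<open>Truncated expansions in powers of \<open>\<pi>\<close>, with digits in \<open>S\<close>,
  form the finite net.\<close>

lemma finite_cover_unit_ball:
  assumes "finite S" "\<And>x. v x \<le> 1 \<Longrightarrow> \<exists>s\<in>S. v (x - s) < 1"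
  shows "\<exists>T. finite T \<and> (\<forall>x. v x \<le> 1 \<longrightarrow> (\<exists>t\<in>T. v (x - t) \<le> v \<pi> ^ n))"
proof (induction n)
  case 0
  then show ?case by (intro exI[of _ "{0}"]) simp
next
  case (Suc n)
  then obtain T where T: "finite T" "\<And>x. v x \<le> 1 \<Longrightarrow> \<exists>t\<in>T. v (x - t) \<le> v \<pi> ^ n" by blast
  let ?T = "(\<lambda>(t, s). t + \<pi> ^ n * s) ` (T \<times> S)"
  have "\<exists>t\<in>?T. v (x - t) \<le> v \<pi> ^ Suc n" if x: "v x \<le> 1" for x
  proof -
    obtain t where t: "t \<in> T" "v (x - t) \<le> v \<pi> ^ n" using T(2) x by blast
    let ?u = "(x - t) / \<pi> ^ n"
    have "v ?u \<le> 1" using t by (simp add: v_divide v_power)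
    then obtain s where s: "s \<in> S" "v (?u - s) < 1" using assms(2) by blast
    have "x - (t + \<pi> ^ n * s) = \<pi> ^ n * (?u - s)" by (simp add: field_simps)
    then have "v (x - (t + \<pi> ^ n * s)) = v \<pi> ^ n * v (?u - s)" by (simp only: v_mult v_power)
    also have "\<dots> \<le> v \<pi> ^ Suc n" using v_less_1[OF s(2)] by (simp add: mult.commute)
    finally show ?thesis using t s by force
  qed
  then show ?case using T(1) assms(1) by (intro exI[of _ ?T]) blast
qed

lemma finite_cover_ball:
  assumes "finite S" "\<And>x. v x \<le> 1 \<Longrightarrow> \<exists>s\<in>S. v (x - s) < 1" and "0 < \<delta>"
  shows "\<exists>T. finite T \<and> (\<forall>x. v x \<le> r \<longrightarrow> (\<exists>t\<in>T. v (x - t) \<le> \<delta>))"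
proof -
  have small: "\<exists>k. v \<pi> ^ k * c < e" if "0 < e" for c e
  proof -
    have "(\<lambda>k. v \<pi> ^ k * c) \<longlonglongrightarrow> 0"
      using LIMSEQ_power_zero[of "v \<pi>"] v_pi_less_1 by (intro tendsto_mult_left_zero) simp
    then show ?thesis
      using order_tendstoD(2)[of _ 0 sequentially e] that by (auto simp: eventually_sequentially)
  qed
  \<comment> \<open>Scaling by \<open>\<pi> ^ k\<close> moves the ball into the unit ball; the
    precision \<open>n\<close> then has to make up for this factor.\<close>
  obtain k where k: "v \<pi> ^ k * r < 1" using small[of 1 r] by auto
  obtain n where n: "v \<pi> ^ n * 1 < \<delta> * v \<pi> ^ k"
    using small[of "\<delta> * v \<pi> ^ k" 1] assms(3) by auto
  obtain T where T: "finite T" "\<And>x. v x \<le> 1 \<Longrightarrow> \<exists>t\<in>T. v (x - t) \<le> v \<pi> ^ n"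
    using finite_cover_unit_ball[OF assms(1,2)] by metis
  have "\<exists>t\<in>(\<lambda>t. t / \<pi> ^ k) ` T. v (x - t) \<le> \<delta>" if x: "v x \<le> r" for x
  proof -
    have "v (\<pi> ^ k * x) \<le> v \<pi> ^ k * r"
      using x by (simp add: v_mult v_power mult_left_mono)
    then obtain t where t: "t \<in> T" "v (\<pi> ^ k * x - t) \<le> v \<pi> ^ n" using T(2) k by force
    have "x - t / \<pi> ^ k = (\<pi> ^ k * x - t) / \<pi> ^ k" by (simp add: field_simps)
    then have "v (x - t / \<pi> ^ k) = v (\<pi> ^ k * x - t) / v \<pi> ^ k" by (simp only: v_divide v_power)
    also have "\<dots> \<le> \<delta>" using t(2) n by (simp add: pos_divide_le_eq)
    finally show ?thesis using t(1) by blast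
  qed
  then show ?thesis using T(1) by (intro exI[of _ "(\<lambda>t. t / \<pi> ^ k) ` T"]) blast
qed

text \<open>Rounding entries to a finite net sends infinitely many elements to one matrix. They all
  lie close to one of them, \<open>A\<close>, so left multiplication by its inverse puts them into
  the finite set \<open>F\<close> of elements near the identity.\<close>

lemma finite_bounded_part_of_discrete:
  assumes S: "finite S" "\<And>x. v x \<le> 1 \<Longrightarrow> \<exists>s\<in>S. v (x - s) < 1"
    and H: "subgroup H SL2"
    and "0 < e" "finite F" and F: "\<And>B. B \<in> H \<Longrightarrow> m2dist v m2one B < e \<Longrightarrow> B \<in> F"
  shows "finite {A \<in> H. m2norm A \<le> r}"
proof (rule ccontr)
  assume inf: "infinite {A \<in> H. m2norm A \<le> r}"
  \<comment> \<open>Multiplication by the inverse of \<open>A\<close> enlarges distances by at most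
    \<open>m2norm A\<close>, which is at most \<open>r\<close>; the added 1 keeps the denominator
    positive.\<close>
  define \<delta> where "\<delta> = e / (\<bar>r\<bar> + 1)"
  have \<delta>: "0 < \<delta>" "\<bar>r\<bar> * \<delta> < e" using \<open>0 < e\<close> by (simp_all add: \<delta>_def field_simps)
  obtain T where T: "finite T" "\<And>x. v x \<le> r \<Longrightarrow> \<exists>t\<in>T. v (x - t) \<le> \<delta>"
    using finite_cover_ball[OF S \<delta>(1)] by metis
  then obtain f where f: "\<And>x. v x \<le> r \<Longrightarrow> f x \<in> T \<and> v (x - f x) \<le> \<delta>" by metis
  have "map_mat2 f ` {A \<in> H. m2norm A \<le> r} \<subseteq> (\<lambda>(a, b, c, d). M2 a b c d) ` (T \<times> T \<times> T \<times> T)"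
  proof (rule image_subsetI)
    fix A assume "A \<in> {A \<in> H. m2norm A \<le> r}"
    then show "map_mat2 f A \<in> (\<lambda>(a, b, c, d). M2 a b c d) ` (T \<times> T \<times> T \<times> T)"
      using f by (cases A) (auto simp: image_iff)
  qed
  then have "finite (map_mat2 f ` {A \<in> H. m2norm A \<le> r})"
    using T(1) by (meson finite_SigmaI finite_imageI finite_subset)
  then obtain A where A: "A \<in> H" "m2norm A \<le> r"
    and inf': "infinite {B \<in> {A \<in> H. m2norm A \<le> r}. map_mat2 f B = map_mat2 f A}"
    using pigeonhole_infinite[OF inf] by blast
  have det: "m2det A = 1"
    using subgroup.subset[OF H] A carrier_SL2 by blast
  have close: "v (x - y) \<le> \<delta>" if "v x \<le> r" "v y \<le> r" "f x = f y" for x y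
    using v_diff[of "x - f x" "y - f y"] f[OF that(1)] f[OF that(2)] that(3)
    by (auto simp: max_def split: if_splits)
  have "B \<in> m2mult A ` F" if B: "B \<in> H" "m2norm B \<le> r" "map_mat2 f B = map_mat2 f A" for B
  proof -
    have "m2dist v A B \<le> \<delta>"
      using A(2) B(2,3) close by (cases A; cases B) simp
    then have "m2norm A * m2dist v A B \<le> \<bar>r\<bar> * \<delta>"
      using A(2) by (intro mult_mono) (auto simp: m2dist_eq)
    then have "m2dist v m2one (m2mult (m2adj A) B) < e"
      using m2dist_adj_mult[OF det, of B] \<delta>(2) by linarith
    moreover have "inv\<^bsub>SL2\<^esub> A = m2adj A"
      using group.inv_equality[OF group_SL2, of "m2adj A" A] det by (simp add: carrier_SL2 m2adj_self)
    then have "m2mult (m2adj A) B \<in> H"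
      using subgroup.m_inv_closed[OF H A(1)] subgroup.m_closed[OF H _ B(1)] by fastforce
    ultimately have "m2mult (m2adj A) B \<in> F" using F by blast
    then show ?thesis
      using m2adj_cancel(2)[of A B] det by (metis image_eqI m2smult_one)
  qed
  then have "{B \<in> {A \<in> H. m2norm A \<le> r}. map_mat2 f B = map_mat2 f A} \<subseteq> m2mult A ` F" by blast
  then show False using inf' \<open>finite F\<close> finite_subset by blast
qed

end

section \<open>Lifting from the projective group\<close>

lemma m2neg_one_square: "m2mult m2neg_one m2neg_one = (m2one :: 'a::comm_ring_1 mat2)"
  by (simp add: m2neg_one_def m2one_def)

lemma m2neg_one_commute: "m2mult m2neg_one A = m2mult A m2neg_one"
  by (simp add: m2mult_neg_one)

lemma m2neg_one_neq_one:
  assumes "(2::'a::field) \<noteq> 0"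
  shows "(m2neg_one :: 'a mat2) \<noteq> m2one"
proof
  assume "(m2neg_one :: 'a mat2) = m2one"
  then have "(1::'a) = - 1" by (simp add: m2neg_one_def m2one_def)
  then have "(1::'a) + 1 = 0" by (metis add.right_inverse)
  then show False using assms by simp
qed

lemma m2neg_one_carrier [simp]: "m2neg_one \<in> carrier SL2"
  by (simp add: carrier_SL2 m2neg_one_def)

lemma m2one_carrier [simp]: "m2one \<in> carrier SL2"
  by (simp add: carrier_SL2)

text \<open>By the Cayley--Hamilton theorem \<open>A\<^sup>2 = 1\<close> gives \<open>tr A \<cdot> A = 2\<close>, so \<open>A\<close> is scalar.\<close>

lemma SL2_square_eq_one:
  fixes A :: "'a::field mat2"
  assumes "(2::'a) \<noteq> 0" "A \<in> carrier SL2" "m2mult A A = m2one"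
  shows "A \<in> centre2"
proof -
  obtain a b c d where A: "A = M2 a b c d" by (cases A)
  have det: "a * d - b * c = 1" using assms(2) by (simp add: A carrier_SL2)
  have sq: "a * a + b * c = 1" "(a + d) * b = 0" "(a + d) * c = 0" "c * b + d * d = 1"
    using assms(3) by (simp_all add: A m2one_def algebra_simps)
  have tr: "(a + d) * a = 2"
    using det sq(1) by (simp add: algebra_simps)
  then have "a + d \<noteq> 0" using assms(1) by auto
  then have bc: "b = 0" "c = 0" using sq by simp_all
  then have "a * a = 1" "a * d = 1" using sq det by simp_all
  then have "a = d" "a = 1 \<or> a = - 1"
    by (metis mult_cancel_left mult_zero_left zero_neq_one, simp add: square_eq_1_iff)
  then show ?thesis using bc A by (auto simp: centre2_def m2one_def m2neg_one_def)
qed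

lemma centre2_normal: "centre2 \<lhd> (SL2 :: 'a::comm_ring_1 mat2 monoid)"
proof -
  interpret group "SL2 :: 'a mat2 monoid" by (rule group_SL2)
  have inv: "inv\<^bsub>SL2\<^esub> m2neg_one = (m2neg_one :: 'a mat2)"
    by (rule inv_equality) (simp_all add: m2neg_one_square)
  have "subgroup centre2 (SL2 :: 'a mat2 monoid)"
  proof
    show "inv\<^bsub>SL2\<^esub> x \<in> centre2" if "x \<in> centre2" for x :: "'a mat2"
      using that inv inv_one by (auto simp: centre2_def)
  qed (auto simp: centre2_def m2neg_one_square)
  then show ?thesis
  proof (rule normal_invI)
    fix x h :: "'a mat2" assume x: "x \<in> carrier SL2" and h: "h \<in> centre2"
    then have "x \<otimes>\<^bsub>SL2\<^esub> h = h \<otimes>\<^bsub>SL2\<^esub> x" by (auto simp: centre2_def m2neg_one_commute)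
    moreover have "h \<in> carrier SL2" using h by (auto simp: centre2_def)
    ultimately show "x \<otimes>\<^bsub>SL2\<^esub> h \<otimes>\<^bsub>SL2\<^esub> inv\<^bsub>SL2\<^esub> x \<in> centre2"
      using x h by (metis inv_closed m_assoc r_inv r_one)
  qed
qed

lemma proj2_eq: "proj2 A = {A, m2mult m2neg_one A}"
  by (auto simp: proj2_def r_coset_def centre2_def)

lemma proj2_hom: "group_hom SL2 PSL2 (proj2 :: 'a::comm_ring_1 mat2 \<Rightarrow> _)"
proof -
  interpret normal centre2 "SL2 :: 'a mat2 monoid" by (rule centre2_normal)
  show ?thesis
    unfolding PSL2_def proj2_def
    using r_coset_hom_Mod factorgroup_is_group is_group
    by (intro group_hom.intro group_hom_axioms.intro) auto
qed

lemma proj2_surj: "g \<in> carrier PSL2 \<Longrightarrow> \<exists>A\<in>carrier SL2. g = proj2 A"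
  by (auto simp: PSL2_def FactGroup_def RCOSETS_def proj2_def)

lemma proj2_mult:
  "A \<in> carrier SL2 \<Longrightarrow> B \<in> carrier SL2 \<Longrightarrow> proj2 A \<otimes>\<^bsub>PSL2\<^esub> proj2 B = proj2 (m2mult A B)"
  using group_hom.hom_mult[OF proj2_hom] by fastforce

lemma proj2_one: "proj2 m2one = \<one>\<^bsub>PSL2\<^esub>"
  using group_hom.hom_one[OF proj2_hom] by simp

lemma proj2_eq_one_iff: "proj2 (A :: 'a::comm_ring_1 mat2) = \<one>\<^bsub>PSL2\<^esub> \<longleftrightarrow> A \<in> centre2"
proof -
  have one: "\<one>\<^bsub>PSL2\<^esub> = (centre2 :: 'a mat2 set)"
    unfolding proj2_one[symmetric] by (simp add: proj2_eq centre2_def)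
  show ?thesis
    unfolding one by (auto simp: proj2_eq centre2_def m2neg_one_square)
qed

lemma neg_one_in_preimage:
  assumes "subgroup G PSL2"
  shows "m2neg_one \<in> {A \<in> carrier SL2. proj2 A \<in> G}"
proof -
  have "proj2 (m2neg_one :: 'a mat2) = \<one>\<^bsub>PSL2\<^esub>" by (simp add: proj2_eq_one_iff centre2_def)
  then show ?thesis using subgroup.one_closed[OF assms] by simp
qed

lemma subgroup_preimage:
  assumes "subgroup G PSL2"
  shows "subgroup {A \<in> carrier SL2. proj2 A \<in> G} SL2"
proof -
  interpret h: group_hom SL2 PSL2 "proj2 :: 'a mat2 \<Rightarrow> _" by (rule proj2_hom)
  interpret G: subgroup G PSL2 by fact
  show ?thesis
    by unfold_locales (use h.G.m_closed h.hom_mult h.hom_inv h.hom_one in auto)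
qed

text \<open>A neighbourhood isolating the identity in \<open>G\<close> has an open preimage around
  \<open>m2one\<close>, and within the preimage of \<open>G\<close> only the kernel of the
  projection can lie in it.\<close>

lemma PSL2_discrete_near_one:
  assumes "subgroup G PSL2" "PSL2_discrete v G"
  shows "\<exists>e>0. \<forall>B\<in>{A \<in> carrier SL2. proj2 A \<in> G}. m2dist v m2one B < e \<longrightarrow> B \<in> centre2"
proof -
  have "\<one>\<^bsub>PSL2\<^esub> \<in> G" using subgroup.one_closed assms(1) by blast
  then obtain W where W: "PSL2_open v W" "\<one>\<^bsub>PSL2\<^esub> \<in> W" "W \<inter> G = {\<one>\<^bsub>PSL2\<^esub>}"
    using assms(2) unfolding PSL2_discrete_def by blast
  then have "m2one \<in> {A \<in> carrier SL2. proj2 A \<in> W}" by (simp add: proj2_one)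
  then obtain e where e: "0 < e" "\<And>B. B \<in> carrier SL2 \<Longrightarrow> m2dist v m2one B < e \<Longrightarrow> proj2 B \<in> W"
    using W(1) unfolding PSL2_open_def SL2_open_def by blast
  then have "B \<in> centre2" if "B \<in> carrier SL2" "proj2 B \<in> G" "m2dist v m2one B < e" for B
    using that W(3) proj2_eq_one_iff by blast
  then show ?thesis using e(1) by blast
qed

context discrete_valuation
begin

lemma discrete_subgroup_character:
  assumes S: "finite S" "\<And>x. v x \<le> 1 \<Longrightarrow> \<exists>s\<in>S. v (x - s) < 1"
    and two: "(2::'k) \<noteq> 0"
    and H: "subgroup H SL2" "m2neg_one \<in> H"
    and discrete: "0 < e" "\<And>B. B \<in> H \<Longrightarrow> m2dist v m2one B < e \<Longrightarrow> B \<in> centre2"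
    and sq: "\<And>u. u \<in> H \<Longrightarrow> m2mult u u \<in> centre2 \<Longrightarrow> u \<in> centre2"
  obtains \<chi> where "\<And>g h. g \<in> H \<Longrightarrow> h \<in> H \<Longrightarrow> \<chi> (m2mult g h) \<longleftrightarrow> (\<chi> g \<longleftrightarrow> \<chi> h)" "\<not> \<chi> m2neg_one"
proof -
  let ?H = "SL2\<lparr>carrier := H\<rparr> :: 'k mat2 monoid"
  interpret tree_action ?H translate vertices adjacent parent even_vertex
    by (rule tree_action_SL2[OF H(1)])
  interpret central_involution ?H m2neg_one
    using H two sq
    by unfold_locales
      (simp_all add: m2neg_one_square m2neg_one_neq_one centre2_def, rule m2neg_one_commute)
  have fin: "finite {g \<in> carrier ?H. translate g x = x}" if x: "x \<in> vertices" for x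
  proof -
    obtain A where A: "m2det A \<noteq> 0" "x = vertex A" using x by (auto simp: vertices_def)
    have "m2det g = 1" if "g \<in> H" for g
      using subgroup.subset[OF H(1)] that carrier_SL2 by blast
    then have "{g \<in> carrier ?H. translate g x = x} \<subseteq> {g \<in> H. m2norm g \<le> (m2norm A)\<^sup>2 / v (m2det A)}"
      using A m2norm_stabiliser_le by auto
    moreover have "finite {g \<in> H. m2norm g \<le> (m2norm A)\<^sup>2 / v (m2det A)}"
      by (rule finite_bounded_part_of_discrete[OF S H(1) discrete(1) _ discrete(2)])
        (simp_all add: centre2_def)
    ultimately show ?thesis by (rule finite_subset)
  qed
  obtain \<chi> where \<chi>: "\<And>g h. g \<in> carrier ?H \<Longrightarrow> h \<in> carrier ?H \<Longrightarrow> \<chi> (g \<otimes>\<^bsub>?H\<^esub> h) \<longleftrightarrow> (\<chi> g \<longleftrightarrow> \<chi> h)"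
    "\<And>g x. g \<in> carrier ?H \<Longrightarrow> x \<in> vertices \<Longrightarrow> translate g x = x \<Longrightarrow> \<chi> g \<longleftrightarrow> odd_order g"
  proof (rule global_character[of odd_order])
    show "vertices \<noteq> {}" by (metis empty_iff m2det_one one_neq_zero vertex_in_vertices)
    show "odd_order (g \<otimes>\<^bsub>?H\<^esub> h) \<longleftrightarrow> (odd_order g \<longleftrightarrow> odd_order h)"
      if "g \<in> carrier ?H" "h \<in> carrier ?H" "x \<in> vertices" "translate g x = x" "translate h x = x" for g h x
      using odd_order_mult[OF stabiliser_subgroup[OF that(3)] fin[OF that(3)], of g h] that
        translate_neg_one[OF that(3)] H(2) by simp
  qed (use odd_order_conjugate in auto)
  show thesis
  proof
    show "\<chi> (m2mult g h) \<longleftrightarrow> (\<chi> g \<longleftrightarrow> \<chi> h)" if "g \<in> H" "h \<in> H" for g h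
      using \<chi>(1)[of g h] that by simp
    \<comment> \<open>The matrix \<open>m2neg_one\<close> fixes every vertex, so
      \<open>\<chi>\<close> agrees there with \<open>odd_order\<close>.\<close>
    show "\<not> \<chi> m2neg_one"
      using \<chi>(2)[of m2neg_one "vertex m2one"] translate_neg_one[of "vertex m2one"]
        not_odd_order_z H(2) by simp
  qed
qed

end

text \<open>The supremum \<open>\<rho>\<close> of the values below 1 is attained. Some
  \<open>v x\<close> lies above \<open>\<rho> * \<rho>\<close>; if it were below
  \<open>\<rho>\<close>, a larger value \<open>v y\<close> below 1 would give the quotient
  \<open>x / y\<close> a value at most \<open>\<rho>\<close>, forcing \<open>v x\<close> down to
  \<open>\<rho> * \<rho>\<close>.\<close>

lemma ex_uniformizer:
  assumes "nonarch_local_field v"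
  shows "\<exists>\<pi>. discrete_valuation v \<pi>"
proof -
  have nonneg: "\<And>x. 0 \<le> v x" and eq0: "\<And>x. v x = 0 \<longleftrightarrow> x = 0"
    and mult: "\<And>x y. v (x * y) = v x * v y"
    and add: "\<And>x y. v (x + y) \<le> max (v x) (v y)"
    and nontriv: "\<exists>x. v x \<noteq> 0 \<and> v x \<noteq> 1"
    and gap: "\<exists>r<1. \<forall>x. v x < 1 \<longrightarrow> v x \<le> r"
    using assms unfolding nonarch_local_field_def by blast+
  have div: "v (x / y) = v x / v y" if "y \<noteq> 0" for x y
    using mult[of "x / y" y] that eq0[of y] by (simp add: field_simps)
  have pos: "0 < v x \<longleftrightarrow> x \<noteq> 0" for x using nonneg[of x] eq0[of x] by linarith
  obtain r where r: "r < 1" "\<And>x. v x < 1 \<Longrightarrow> v x \<le> r" using gap by blast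
  define M where "M = v ` {x. v x < 1}"
  have v1: "v 1 = 1" using mult[of 1 1] eq0[of 1] by simp
  obtain x0 where x0: "x0 \<noteq> 0" "v x0 < 1"
  proof -
    obtain x where x: "v x \<noteq> 0" "v x \<noteq> 1" using nontriv by blast
    then have "x \<noteq> 0" using eq0 by blast
    show thesis
    proof (cases "v x < 1")
      case False
      then have "v (1 / x) < 1" using x div[OF \<open>x \<noteq> 0\<close>] v1 by simp
      then show thesis using that[of "1 / x"] \<open>x \<noteq> 0\<close> by simp
    qed (use that \<open>x \<noteq> 0\<close> in blast)
  qed
  define \<rho> where "\<rho> = Sup M"
  have bdd: "bdd_above M" using r(2) by (auto simp: M_def intro: bdd_aboveI[of _ r])
  have upper: "v x \<le> \<rho>" if "v x < 1" for x
    unfolding \<rho>_def using that bdd by (intro cSup_upper) (auto simp: M_def)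
  have "0 < \<rho>" using upper[OF x0(2)] pos x0(1) by (meson less_le_trans)
  have "\<rho> \<le> r" unfolding \<rho>_def using x0 r(2) by (intro cSup_least) (auto simp: M_def)
  then have "\<rho> < 1" using r(1) by simp
  have approx: "\<exists>x. v x < 1 \<and> b < v x" if "b < \<rho>" for b
    using less_cSupD[of M b] that x0 unfolding \<rho>_def M_def by blast
  have "\<rho> * \<rho> < \<rho>" using \<open>0 < \<rho>\<close> \<open>\<rho> < 1\<close> by simp
  then obtain x where x: "v x < 1" "\<rho> * \<rho> < v x" using approx by blast
  have "v x = \<rho>"
  proof (rule ccontr)
    assume "v x \<noteq> \<rho>"
    then have "v x < \<rho>" using upper[OF x(1)] by simp
    then obtain y where y: "v y < 1" "v x < v y" using approx by blast
    then have "0 < v y" using nonneg[of x] by linarith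
    then have "y \<noteq> 0" using pos by blast
    have "v x / v y \<le> \<rho>"
      using upper[of "x / y"] y \<open>0 < v y\<close> by (simp add: div[OF \<open>y \<noteq> 0\<close>])
    then have "v x \<le> \<rho> * v y" using \<open>0 < v y\<close> by (simp add: field_simps)
    also have "\<dots> \<le> \<rho> * \<rho>" using upper[OF y(1)] \<open>0 < \<rho>\<close> by simp
    finally show False using x(2) by simp
  qed
  then have "discrete_valuation v x"
    using nonneg eq0 mult add \<open>0 < \<rho>\<close> \<open>\<rho> < 1\<close> upper by unfold_locales simp_all
  then show ?thesis ..
qed

text \<open>The lift of an element of order two squares to the identity matrix, so it is central and
  projects to the identity.\<close>

lemma no_2_torsion_if_lifts:
  fixes G :: "'k::field mat2 set set"
  assumes "(2::'k) \<noteq> 0" "subgroup G PSL2" "lifts_to_SL2 G"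
  shows "\<not> has_2_torsion G"
proof
  assume "has_2_torsion G"
  then obtain g where g: "g \<in> G" "g \<noteq> \<one>\<^bsub>PSL2\<^esub>" "g \<otimes>\<^bsub>PSL2\<^esub> g = \<one>\<^bsub>PSL2\<^esub>"
    by (auto simp: has_2_torsion_def)
  obtain \<phi> where \<phi>: "\<phi> \<in> hom (PSL2\<lparr>carrier := G\<rparr>) SL2" "\<And>g. g \<in> G \<Longrightarrow> proj2 (\<phi> g) = g"
    using assms(3) by (auto simp: lifts_to_SL2_def)
  interpret \<phi>: group_hom "PSL2\<lparr>carrier := G\<rparr>" SL2 \<phi>
    using \<phi>(1) group_SL2 subgroup.subgroup_is_group[OF assms(2)] group_hom.axioms(2)[OF proj2_hom]
    by (intro group_hom.intro group_hom_axioms.intro) auto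
  have "m2mult (\<phi> g) (\<phi> g) = m2one"
    using \<phi>.hom_mult[of g g] \<phi>.hom_one g by simp
  moreover have "\<phi> g \<in> carrier SL2" using \<phi>.hom_closed g(1) by simp
  ultimately have "\<phi> g \<in> centre2" using SL2_square_eq_one assms(1) by blast
  then show False using proj2_eq_one_iff \<phi>(2) g by metis
qed

text \<open>An element of \<open>G\<close> is a coset consisting of a matrix and its negative, on
  which \<open>\<chi>\<close> takes opposite values. The lift selects the member where
  \<open>\<chi>\<close> holds.\<close>

lemma lifts_if_character:
  fixes G :: "'k::field mat2 set set"
  defines "H \<equiv> {A \<in> carrier SL2. proj2 A \<in> G}"
  assumes G: "subgroup G PSL2"
    and \<chi>: "\<And>g h. g \<in> H \<Longrightarrow> h \<in> H \<Longrightarrow> \<chi> (m2mult g h) \<longleftrightarrow> (\<chi> g \<longleftrightarrow> \<chi> h)" "\<not> \<chi> m2neg_one"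
  shows "lifts_to_SL2 G"
proof -
  have H: "subgroup H SL2" unfolding H_def by (rule subgroup_preimage[OF G])
  have neg: "m2neg_one \<in> H" unfolding H_def by (rule neg_one_in_preimage[OF G])
  have ex1: "\<exists>!A. A \<in> g \<and> \<chi> A" and sub: "g \<subseteq> H" and pr: "\<And>A. A \<in> g \<Longrightarrow> proj2 A = g" if g: "g \<in> G" for g
  proof -
    obtain B where B: "B \<in> carrier SL2" "g = proj2 B"
      using proj2_surj subgroup.subset[OF G] g by blast
    then have BH: "B \<in> H" using g by (simp add: H_def)
    have "\<chi> (m2mult m2neg_one B) \<longleftrightarrow> \<not> \<chi> B" using \<chi> neg BH by blast
    then show "\<exists>!A. A \<in> g \<and> \<chi> A" unfolding B proj2_eq by blast
    show "g \<subseteq> H"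
      using BH subgroup.m_closed[OF H neg BH] by (simp add: B proj2_eq)
    show "\<And>A. A \<in> g \<Longrightarrow> proj2 A = g"
      by (auto simp: B proj2_eq m2neg_one_square simp flip: m2mult_assoc)
  qed
  define \<phi> where "\<phi> g = (THE A. A \<in> g \<and> \<chi> A)" for g
  have \<phi>: "\<phi> g \<in> g" "\<chi> (\<phi> g)" if "g \<in> G" for g
    using theI'[OF ex1[OF that]] by (simp_all add: \<phi>_def)
  have \<phi>H: "\<phi> g \<in> H" if "g \<in> G" for g using \<phi>(1)[OF that] sub[OF that] by blast
  have \<phi>_eq: "\<phi> g = A" if "g \<in> G" "A \<in> g" "\<chi> A" for g A
    using the1_equality[OF ex1[OF that(1)]] that by (simp add: \<phi>_def)
  have "\<phi> (g \<otimes>\<^bsub>PSL2\<^esub> h) = m2mult (\<phi> g) (\<phi> h)" if g: "g \<in> G" and h: "h \<in> G" for g h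
  proof (rule \<phi>_eq)
    show "g \<otimes>\<^bsub>PSL2\<^esub> h \<in> G" using subgroup.m_closed[OF G g h] .
    have "proj2 (m2mult (\<phi> g) (\<phi> h)) = g \<otimes>\<^bsub>PSL2\<^esub> h"
      using proj2_mult[of "\<phi> g" "\<phi> h"] \<phi>H[OF g] \<phi>H[OF h] pr[OF g \<phi>(1)[OF g]] pr[OF h \<phi>(1)[OF h]]
      by (simp add: H_def)
    then show "m2mult (\<phi> g) (\<phi> h) \<in> g \<otimes>\<^bsub>PSL2\<^esub> h" by (metis insertI1 proj2_eq)
    show "\<chi> (m2mult (\<phi> g) (\<phi> h))" using \<chi>(1) \<phi>H \<phi>(2) g h by blast
  qed
  then have "\<phi> \<in> hom (PSL2\<lparr>carrier := G\<rparr>) SL2"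
    using \<phi>H by (auto simp: hom_def H_def)
  then show ?thesis
    unfolding lifts_to_SL2_def using pr \<phi>(1) by blast
qed

theorem theoremA:
  fixes v :: "'k::field \<Rightarrow> real" and G :: "'k mat2 set set"
  assumes "nonarch_local_field v"
    and "(2::'k) \<noteq> 0"
    and "subgroup G PSL2"
    and "PSL2_discrete v G"
  shows "lifts_to_SL2 G \<longleftrightarrow> \<not> has_2_torsion G"
proof
  assume "lifts_to_SL2 G"
  then show "\<not> has_2_torsion G" using no_2_torsion_if_lifts assms(2,3) by blast
next
  assume no_torsion: "\<not> has_2_torsion G"
  obtain \<pi> where "discrete_valuation v \<pi>" using ex_uniformizer[OF assms(1)] ..
  then interpret discrete_valuation v \<pi> .
  let ?H = "{A \<in> carrier SL2. proj2 A \<in> G}"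
  obtain S where S: "finite S" "\<And>x. v x \<le> 1 \<Longrightarrow> \<exists>s\<in>S. v (x - s) < 1"
    using assms(1) unfolding nonarch_local_field_def by blast
  obtain e where e: "0 < e" "\<And>B. B \<in> ?H \<Longrightarrow> m2dist v m2one B < e \<Longrightarrow> B \<in> centre2"
    using PSL2_discrete_near_one[OF assms(3,4)] by blast
  \<comment> \<open>Absence of 2-torsion in \<open>G\<close>, restated for matrices; this becomes
    \<open>square_central\<close> for the preimage.\<close>
  have sq: "u \<in> centre2" if "u \<in> ?H" "m2mult u u \<in> centre2" for u
  proof -
    have "proj2 u \<otimes>\<^bsub>PSL2\<^esub> proj2 u = \<one>\<^bsub>PSL2\<^esub>"
      using that proj2_mult[of u u] proj2_eq_one_iff[of "m2mult u u"] by simp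
    then have "proj2 u = \<one>\<^bsub>PSL2\<^esub>" using no_torsion that(1) unfolding has_2_torsion_def by blast
    then show ?thesis by (simp add: proj2_eq_one_iff)
  qed
  obtain \<chi> where "\<And>g h. g \<in> ?H \<Longrightarrow> h \<in> ?H \<Longrightarrow> \<chi> (m2mult g h) \<longleftrightarrow> (\<chi> g \<longleftrightarrow> \<chi> h)" "\<not> \<chi> m2neg_one"
    using discrete_subgroup_character[OF S assms(2) subgroup_preimage[OF assms(3)]
        neg_one_in_preimage[OF assms(3)] e sq] by blast
  then show "lifts_to_SL2 G" by (rule lifts_if_character[OF assms(3)])
qed

end
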